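(* Let $X$ be a compact space with $\chi(X)\le\aleph_0$ which is a coset space of a subgroup of a product of Čech-complete groups (or on which there is a continuous transitive $d$-open action of a subgroup of a product of Čech-complete groups). Then $X$ is metrizable.
   Context: Compact spaces are Hausdorff. $X$ is a coset space of a topological group $G$ if it is homeomorphic to $G/K$ (quotient topology) for some closed subgroup $K$. An action of $G$ on $X$ is $d$-open if $x\in\operatorname{Int}(\operatorname{cl}(Ox))$ for every $x\in X$ and every neighborhood $O$ of the unit. "Subgroup of a product of Čech-complete groups" means a topological subgroup of a product of Čech-complete topological groups. *)

theory Defs
  imports "HOL-Analysis.Analysis" "HOL-Algebra.Product_Groups" "HOL-Algebra.Coset"
begin

definition topological_group :: "('a, 'b) monoid_scheme \<Rightarrow> 'a topology \<Rightarrow> bool" where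
  "topological_group G T \<longleftrightarrow>
     group G \<and> topspace T = carrier G \<and>
     continuous_map (prod_topology T T) T (\<lambda>(x, y). x \<otimes>\<^bsub>G\<^esub> y) \<and>
     continuous_map T T (\<lambda>x. inv\<^bsub>G\<^esub> x)"

text \<open>Cech-completeness (Engelking): X is a G-delta subset of some compactification,
  i.e. X is homeomorphic to a dense G-delta subspace A of a compact Hausdorff space K.
  The compactification is sought in the type 'k, given by the first argument;
  a free type variable 'k in a hypothesis acts existentially.\<close>
definition cech_complete :: "'k itself \<Rightarrow> 'a topology \<Rightarrow> bool" where
  "cech_complete (_ :: 'k itself) X \<longleftrightarrow>
     (\<exists>(K :: 'k topology) A. compact_space K \<and> Hausdorff_space K \<and>
        A \<subseteq> topspace K \<and> K closure_of A = topspace K \<and> gdelta_in K A \<and>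
        X homeomorphic_space subtopology K A)"

definition cosets_of :: "('a, 'b) monoid_scheme \<Rightarrow> 'a set \<Rightarrow> 'a set set" where
  "cosets_of G K = {x <#\<^bsub>G\<^esub> K | x. x \<in> carrier G}"

definition coset_space :: "('a, 'b) monoid_scheme \<Rightarrow> 'a topology \<Rightarrow> 'a set \<Rightarrow> 'a set topology" where
  "coset_space G T K = topology (\<lambda>\<U>. \<U> \<subseteq> cosets_of G K \<and> openin T (\<Union>\<U>))"

definition cont_trans_dopen_action ::
  "('g, 'b) monoid_scheme \<Rightarrow> 'g topology \<Rightarrow> 'x topology \<Rightarrow> ('g \<Rightarrow> 'x \<Rightarrow> 'x) \<Rightarrow> bool" where
  "cont_trans_dopen_action G T X act \<longleftrightarrow>
     continuous_map (prod_topology T X) X (\<lambda>(g, x). act g x) \<and>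
     (\<forall>x \<in> topspace X. act \<one>\<^bsub>G\<^esub> x = x) \<and>
     (\<forall>g \<in> carrier G. \<forall>h \<in> carrier G. \<forall>x \<in> topspace X.
        act g (act h x) = act (g \<otimes>\<^bsub>G\<^esub> h) x) \<and>
     (\<forall>x \<in> topspace X. \<forall>y \<in> topspace X. \<exists>g \<in> carrier G. act g x = y) \<and>
     (\<forall>x \<in> topspace X. \<forall>U. openin T U \<and> \<one>\<^bsub>G\<^esub> \<in> U \<longrightarrow>
        x \<in> X interior_of (X closure_of ((\<lambda>g. act g x) ` U)))"

end

theory Submission
  imports Defs
begin

text \<open>Fix a point \<open>x\<close> and a countable base at \<open>x\<close>. Only countably many coordinates \<open>J\<close> are needed to
  witness continuity of the orbit map at \<open>x\<close>; as the neighbourhoods of the unit given by \<open>J\<close> are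
  stable under conjugation, transitivity carries this to all points, and \<open>d\<close>-openness turns
  pointwise into joint continuity. So one may replace the product by the countable product over
  \<open>J\<close>. Cech-completeness is used only through a consequence that passes to countable products and
  subgroups: there are neighbourhoods \<open>U n\<close> of the unit such that every neighbourhood \<open>V\<close> has
  \<open>U n \<subseteq> F V\<close> for some \<open>n\<close> and finite \<open>F\<close>. In a completion this says that the \<open>U n\<close> shrink to a
  compact set \<open>K\<close>. Countably many \<open>K\<close>-orbits are dense in \<open>X\<close> and each of them is separable, hence
  \<open>X\<close> is separable. Shrinking the \<open>U n\<close> so that they also contract at every point of a countable
  dense set, total boundedness makes them contract at every point, and the sets
  \<open>Int (cl (U n f))\<close> with \<open>f\<close> from suitable finite sets form a countable base of \<open>X\<close>.\<close>

section \<open>Compact spaces with a countable base\<close>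

lemma compact_Hausdorff_shrink:
  assumes "compact_space X" "Hausdorff_space X" "openin X O1" "x \<in> O1"
  obtains O0 where "openin X O0" "x \<in> O0" "X closure_of O0 \<subseteq> O1"
proof -
  have "regular_space X"
    using assms compact_Hausdorff_imp_regular_space by blast
  moreover have "closedin X (topspace X - O1)" "x \<in> topspace X - (topspace X - O1)"
    using assms openin_subset by auto
  ultimately obtain U where "openin X U" "x \<in> U" "disjnt (topspace X - O1) (X closure_of U)"
    unfolding regular_space by blast
  moreover have "X closure_of U \<subseteq> topspace X"
    by (rule closure_of_subset_topspace)
  ultimately have "X closure_of U \<subseteq> O1"
    by (auto simp: disjnt_def)
  then show thesis
    using that \<open>openin X U\<close> \<open>x \<in> U\<close> by blast
qed

lemma first_countable_decreasing_base:
  assumes "first_countable X" "x \<in> topspace X"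
  obtains B :: "nat \<Rightarrow> 'a set"
  where "\<And>n. openin X (B n)" "\<And>n. x \<in> B n" "decseq B"
    "\<And>U. openin X U \<Longrightarrow> x \<in> U \<Longrightarrow> \<exists>n. B n \<subseteq> U"
proof -
  obtain \<B> where \<B>: "countable \<B>" "\<And>V. V \<in> \<B> \<Longrightarrow> openin X V"
    "\<And>U. openin X U \<Longrightarrow> x \<in> U \<Longrightarrow> \<exists>V \<in> \<B>. x \<in> V \<and> V \<subseteq> U"
    using assms unfolding first_countable_def by meson
  define \<C> where "\<C> = {V \<in> \<B>. x \<in> V}"
  have C: "countable \<C>" "\<C> \<noteq> {}"
    using \<B>(1) \<B>(3)[of "topspace X"] assms(2) by (auto simp: \<C>_def)
  define c where "c = from_nat_into \<C>"
  have c: "range c = \<C>"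
    using C by (simp add: c_def range_from_nat_into)
  define B where "B n = (\<Inter>i\<le>n. c i)" for n
  have cC: "c i \<in> \<C>" for i
    using c by blast
  show thesis
  proof (rule that)
    show "openin X (B n)" for n
      unfolding B_def using cC \<B>(2) by (intro openin_Inter) (auto simp: \<C>_def)
    show "x \<in> B n" for n
      using cC by (auto simp: B_def \<C>_def)
    show "decseq B"
      by (auto simp: decseq_def B_def)
    fix U assume "openin X U" "x \<in> U"
    then obtain V where "V \<in> \<C>" "V \<subseteq> U"
      using \<B>(3) by (auto simp: \<C>_def)
    then obtain n where "c n \<subseteq> U"
      using c by blast
    then show "\<exists>n. B n \<subseteq> U"
      by (auto simp: B_def)
  qed
qed

text \<open>Urysohn's embedding: each pair in \<open>P\<close> gives a continuous real function
  separating the closure of \<open>V\<close> from the complement of \<open>W\<close>, and by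
  regularity these countably many functions separate points. Compactness makes the injection into a
  countable power of the reals an embedding.\<close>

lemma compact_Hausdorff_second_countable_imp_metrizable:
  assumes "compact_space X" "Hausdorff_space X" "second_countable X"
  shows "metrizable_space X"
proof -
  obtain \<B> where \<B>: "countable \<B>" "\<And>V. V \<in> \<B> \<Longrightarrow> openin X V"
    "\<And>U x. openin X U \<Longrightarrow> x \<in> U \<Longrightarrow> \<exists>V \<in> \<B>. x \<in> V \<and> V \<subseteq> U"
    using assms(3) unfolding second_countable_def by meson
  have normal: "normal_space X"
    using assms compact_Hausdorff_or_regular_imp_normal_space by blast
  define P where "P = {(V, W). V \<in> \<B> \<and> W \<in> \<B> \<and> X closure_of V \<subseteq> W}"
  have countable: "countable P"
    by (rule countable_subset[of _ "\<B> \<times> \<B>"]) (use \<B>(1) in \<open>auto simp: P_def\<close>)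
  have "\<exists>f. continuous_map X euclideanreal f \<and> f ` (X closure_of V) \<subseteq> {0} \<and>
      f ` (topspace X - W) \<subseteq> {1}" if "(V, W) \<in> P" for V W
  proof -
    have "disjnt (X closure_of V) (topspace X - W)" "closedin X (topspace X - W)"
      using that \<B>(2) by (auto simp: P_def disjnt_def)
    then show ?thesis
      using Urysohn_lemma_alt[OF normal closedin_closure_of] by metis
  qed
  then have "\<forall>p\<in>P. \<exists>f. continuous_map X euclideanreal f \<and> f ` (X closure_of fst p) \<subseteq> {0} \<and>
      f ` (topspace X - snd p) \<subseteq> {1}"
    by auto
  then obtain f where f: "\<And>p. p \<in> P \<Longrightarrow> continuous_map X euclideanreal (f p)"
    "\<And>p. p \<in> P \<Longrightarrow> f p ` (X closure_of fst p) \<subseteq> {0}"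
    "\<And>p. p \<in> P \<Longrightarrow> f p ` (topspace X - snd p) \<subseteq> {1}"
    by metis
  define e where "e x = (\<lambda>p\<in>P. f p x)" for x
  let ?Y = "product_topology (\<lambda>p. euclideanreal) P"
  have "continuous_map X ?Y e"
    by (auto simp: continuous_map_componentwise e_def f(1))
  moreover have "Hausdorff_space ?Y"
    by (simp add: Hausdorff_space_product_topology)
  ultimately have "closed_map X ?Y e"
    using assms(1) by (simp add: T1_Spaces.continuous_imp_closed_map)
  moreover have "inj_on e (topspace X)"
  proof (rule inj_onI, rule ccontr)
    fix x y assume xy: "x \<in> topspace X" "y \<in> topspace X" "e x = e y" "x \<noteq> y"
    have "openin X (topspace X - {y})"
      using assms(2) xy by (simp add: closedin_Hausdorff_singleton openin_diff)
    then obtain W where W: "W \<in> \<B>" "x \<in> W" "W \<subseteq> topspace X - {y}"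
      using \<B>(3) xy by (metis Diff_iff insertE empty_iff)
    then obtain O0 where O0: "openin X O0" "x \<in> O0" "X closure_of O0 \<subseteq> W"
      using compact_Hausdorff_shrink[OF assms(1,2)] \<B>(2) by metis
    then obtain V where V: "V \<in> \<B>" "x \<in> V" "V \<subseteq> O0"
      using \<B>(3) by blast
    then have p: "(V, W) \<in> P"
      using W O0 closure_of_mono[of V O0 X] by (auto simp: P_def)
    have "x \<in> X closure_of V"
      using V \<B>(2) closure_of_subset[of V X] openin_subset by blast
    then have "f (V, W) x = 0"
      using f(2)[OF p] by auto
    moreover have "f (V, W) y = 1"
      using f(3)[OF p] xy W by auto
    moreover have "f (V, W) x = f (V, W) y"
      using xy(3) p by (auto simp: e_def fun_eq_iff restrict_def split: if_splits)
    ultimately show False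
      by simp
  qed
  ultimately have "embedding_map X ?Y e"
    using \<open>continuous_map X ?Y e\<close> injective_closed_imp_embedding_map by blast
  moreover have "metrizable_space ?Y"
    using countable
    by (auto simp: metrizable_space_product_topology metrizable_space_euclidean
        intro!: countable_subset[OF _ countable])
  ultimately show ?thesis
    using embedding_map_imp_homeomorphic_space homeomorphic_metrizable_space
      metrizable_space_subtopology by metis
qed

lemma closure_of_meets:
  "x \<in> X closure_of S \<Longrightarrow> openin X T \<Longrightarrow> x \<in> T \<Longrightarrow> \<exists>y\<in>S. y \<in> T"
  by (auto simp: in_closure_of)

section \<open>Actions of groups with totally bounded neighbourhoods\<close>

text \<open>\<open>NB\<close> acts as a base of symmetric neighbourhoods of the unit, with no
  topology fixed on the group. It will consist of cylinders over countably many coordinates, so it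
  may be coarser than the given topology and need not separate points of the group.
  \<open>U_total\<close> is what Cech-completeness leaves behind; \<open>act_near\<close> is
  continuity of orbit maps at the unit, from which joint continuity is derived.\<close>

locale nbhd_action = group G for G (structure) +
  fixes X :: "'x topology" and act :: "'a \<Rightarrow> 'x \<Rightarrow> 'x"
    and NB :: "'a set set" and U :: "nat \<Rightarrow> 'a set"
  assumes compact: "compact_space X"
    and Hausdorff: "Hausdorff_space X"
    and first_countable: "first_countable X"
    and act_cont: "g \<in> carrier G \<Longrightarrow> continuous_map X X (act g)"
    and act_one: "x \<in> topspace X \<Longrightarrow> act \<one> x = x"
    and act_mult: "g \<in> carrier G \<Longrightarrow> h \<in> carrier G \<Longrightarrow> x \<in> topspace X \<Longrightarrow>
        act g (act h x) = act (g \<otimes> h) x"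
    and NB_carrier: "V \<in> NB \<Longrightarrow> V \<subseteq> carrier G"
    and NB_one: "V \<in> NB \<Longrightarrow> \<one> \<in> V"
    and NB_inv: "V \<in> NB \<Longrightarrow> v \<in> V \<Longrightarrow> inv v \<in> V"
    and NB_Int: "V \<in> NB \<Longrightarrow> W \<in> NB \<Longrightarrow> \<exists>Z\<in>NB. Z \<subseteq> V \<inter> W"
    and NB_square: "V \<in> NB \<Longrightarrow> \<exists>W\<in>NB. \<forall>a\<in>W. \<forall>b\<in>W. a \<otimes> b \<in> V"
    and act_near: "openin X O1 \<Longrightarrow> x \<in> O1 \<Longrightarrow> \<exists>V\<in>NB. \<forall>v\<in>V. act v x \<in> O1"
    and act_dopen: "x \<in> topspace X \<Longrightarrow> V \<in> NB \<Longrightarrow>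
        x \<in> X interior_of (X closure_of ((\<lambda>g. act g x) ` V))"
    and U_NB: "U n \<in> NB"
    and U_dec: "decseq U"
    and U_total: "V \<in> NB \<Longrightarrow> \<exists>n F. finite F \<and> F \<subseteq> carrier G \<and> U n \<subseteq> (\<Union>f\<in>F. f <# V)"
begin

section \<open>Joint continuity and a pigeonhole substitute for convergent subsequences\<close>

lemma act_closed: "g \<in> carrier G \<Longrightarrow> x \<in> topspace X \<Longrightarrow> act g x \<in> topspace X"
  using act_cont[of g] by (auto simp: continuous_map_def)

lemma act_inv_left: "g \<in> carrier G \<Longrightarrow> x \<in> topspace X \<Longrightarrow> act (inv g) (act g x) = x"
  by (simp add: act_mult act_one)

lemma act_preimage_open:
  "g \<in> carrier G \<Longrightarrow> openin X O1 \<Longrightarrow> openin X {x \<in> topspace X. act g x \<in> O1}"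
  using act_cont[of g] by (simp add: openin_continuous_map_preimage)

lemma act_NB_carrier: "V \<in> NB \<Longrightarrow> v \<in> V \<Longrightarrow> v \<in> carrier G"
  using NB_carrier by blast

lemma U_mono: "n \<le> m \<Longrightarrow> u \<in> U m \<Longrightarrow> u \<in> U n"
  using decseqD[OF U_dec] by blast

text \<open>By \<open>d\<close>-openness a whole neighbourhood of \<open>x\<close> lies in the
  closure of the orbit piece \<open>W x\<close>. An element \<open>w\<close> maps that closure into
  the closure of \<open>w W x\<close>, and \<open>w W x\<close> lies in \<open>V x\<close>, hence in
  \<open>A\<close>.\<close>

lemma joint_closure:
  assumes W: "W \<in> NB" and V: "\<And>a b. a \<in> W \<Longrightarrow> b \<in> W \<Longrightarrow> a \<otimes> b \<in> V"
    and x: "x \<in> topspace X" and VA: "\<And>v. v \<in> V \<Longrightarrow> act v x \<in> A"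
  obtains O' where "openin X O'" "x \<in> O'"
    "\<And>w y. w \<in> W \<Longrightarrow> y \<in> O' \<Longrightarrow> act w y \<in> X closure_of A"
proof
  let ?O = "X interior_of (X closure_of ((\<lambda>g. act g x) ` W))"
  show "openin X ?O" "x \<in> ?O"
    using act_dopen x W by auto
  fix w y assume w: "w \<in> W" and "y \<in> ?O"
  then have "y \<in> X closure_of ((\<lambda>g. act g x) ` W)"
    using interior_of_subset by fast
  then have "act w y \<in> act w ` (X closure_of ((\<lambda>g. act g x) ` W))"
    by (rule imageI)
  also have "\<dots> \<subseteq> X closure_of (act w ` (\<lambda>g. act g x) ` W)"
    using act_NB_carrier[OF W w] by (intro continuous_map_image_closure_subset act_cont)
  finally have "act w y \<in> X closure_of (act w ` (\<lambda>g. act g x) ` W)" .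
  moreover have "act w ` (\<lambda>g. act g x) ` W \<subseteq> A"
    using V VA w x act_NB_carrier[OF W] by (auto simp: act_mult)
  ultimately show "act w y \<in> X closure_of A"
    using closure_of_mono subsetD by metis
qed

text \<open>Regularity absorbs the closure left by \<open>joint_closure\<close>: continuity of the
  orbit map is used for a smaller \<open>O0\<close> whose closure is still inside
  \<open>O1\<close>.\<close>

lemma joint:
  assumes "openin X O1" "x \<in> O1"
  obtains V O' where "V \<in> NB" "openin X O'" "x \<in> O'"
    "\<And>v y. v \<in> V \<Longrightarrow> y \<in> O' \<Longrightarrow> act v y \<in> O1"
proof -
  obtain O0 where O0: "openin X O0" "x \<in> O0" "X closure_of O0 \<subseteq> O1"
    using compact_Hausdorff_shrink[OF compact Hausdorff assms] .
  obtain V where V: "V \<in> NB" "\<And>v. v \<in> V \<Longrightarrow> act v x \<in> O0"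
    using act_near[OF O0(1,2)] by blast
  obtain W where W: "W \<in> NB" "\<And>a b. a \<in> W \<Longrightarrow> b \<in> W \<Longrightarrow> a \<otimes> b \<in> V"
    using NB_square[OF V(1)] by blast
  have "x \<in> topspace X"
    using assms openin_subset by blast
  from joint_closure[OF W this V(2)] obtain O' where "openin X O'" "x \<in> O'"
    "\<And>w y. w \<in> W \<Longrightarrow> y \<in> O' \<Longrightarrow> act w y \<in> X closure_of O0"
    by blast
  then show thesis
    using that[OF W(1)] O0(3) by blast
qed

text \<open>This replaces a convergent subsequence: infinitely many terms lie in one translate of
  \<open>V\<close>, and \<open>b\<close> plays the role of an approximate limit without any
  completeness of the group.\<close>

lemma pigeonhole_left:
  assumes u: "\<And>m. u m \<in> U m" and V: "V \<in> NB"
  obtains b where "b \<in> carrier G" "infinite {m. \<exists>v\<in>V. u m = b \<otimes> v}"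
proof -
  obtain n F where F: "finite F" "F \<subseteq> carrier G" "U n \<subseteq> (\<Union>f\<in>F. f <# V)"
    using U_total[OF V] by blast
  have "m \<in> {..<n} \<union> (\<Union>f\<in>F. {m. \<exists>v\<in>V. u m = f \<otimes> v})" for m
  proof (cases "m < n")
    case False
    then have "u m \<in> U n"
      using U_mono[OF _ u] False by simp
    then show ?thesis
      using F by (auto simp: l_coset_def)
  qed auto
  then have "UNIV \<subseteq> {..<n} \<union> (\<Union>f\<in>F. {m. \<exists>v\<in>V. u m = f \<otimes> v})"
    by (rule subsetI)
  then have "infinite ({..<n} \<union> (\<Union>f\<in>F. {m. \<exists>v\<in>V. u m = f \<otimes> v}))"
    by (rule infinite_super) (rule infinite_UNIV_nat)
  then have "infinite (\<Union>f\<in>F. {m. \<exists>v\<in>V. u m = f \<otimes> v})"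
    by simp
  then obtain f where "f \<in> F" "infinite {m. \<exists>v\<in>V. u m = f \<otimes> v}"
    using F(1) finite_UN by blast
  then show thesis
    using that F(2) by blast
qed

text \<open>Inversion exchanges left and right translates, since the members of \<open>NB\<close>
  are symmetric. In \<open>v \<otimes> b\<close> the small factor acts last, which is the order
  needed for comparing images of a point.\<close>

lemma pigeonhole_right:
  assumes u: "\<And>m. u m \<in> U m" and V: "V \<in> NB"
  obtains b where "b \<in> carrier G" "infinite {m. \<exists>v\<in>V. u m = v \<otimes> b}"
proof -
  obtain b where b: "b \<in> carrier G" "infinite {m. \<exists>v\<in>V. inv (u m) = b \<otimes> v}"
    using pigeonhole_left[OF _ V, of "\<lambda>m. inv (u m)"] NB_inv[OF U_NB u] by blast
  have "{m. \<exists>v\<in>V. inv (u m) = b \<otimes> v} \<subseteq> {m. \<exists>v\<in>V. u m = v \<otimes> inv b}"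
  proof clarify
    fix m v assume v: "v \<in> V" "inv (u m) = b \<otimes> v"
    have "u m = inv (b \<otimes> v)"
      using v(2) act_NB_carrier[OF U_NB u[of m]] by (metis inv_inv)
    then have "u m = inv v \<otimes> inv b"
      using b(1) v(1) act_NB_carrier[OF V] by (simp add: inv_mult_group)
    then show "\<exists>v\<in>V. u m = v \<otimes> inv b"
      using NB_inv[OF V v(1)] by blast
  qed
  then show thesis
    using that b by (meson infinite_super inv_closed)
qed

text \<open>In a completion of the group the intersection \<open>K\<close> of the closures of the \<open>U l\<close> is compact
  and the \<open>U n\<close> shrink to \<open>K\<close>; this is the trace of that fact inside the group itself, where
  the intersection of the \<open>U l\<close> may well be trivial.\<close>

lemma U_absorb:
  assumes V: "V \<in> NB"
  obtains n where "\<And>l u. u \<in> U n \<Longrightarrow> \<exists>a\<in>U l. \<exists>v\<in>V. u = a \<otimes> v"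
proof (rule ccontr)
  assume "\<not> thesis"
  with that have "\<forall>n. \<exists>l u. u \<in> U n \<and> (\<forall>a\<in>U l. \<forall>v\<in>V. u \<noteq> a \<otimes> v)"
    by meson
  then obtain l u where u: "\<And>n. u n \<in> U n" and lu: "\<And>n a v. a \<in> U (l n) \<Longrightarrow> v \<in> V \<Longrightarrow> u n \<noteq> a \<otimes> v"
    by metis
  obtain W where W: "W \<in> NB" "\<And>a b. a \<in> W \<Longrightarrow> b \<in> W \<Longrightarrow> a \<otimes> b \<in> V"
    using NB_square[OF V] by blast
  obtain b where b: "b \<in> carrier G" "infinite {m. \<exists>v\<in>W. u m = b \<otimes> v}"
    using pigeonhole_left[OF u W(1)] .
  from infinite_imp_nonempty[OF b(2)] obtain n v where n: "v \<in> W" "u n = b \<otimes> v"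
    by blast
  \<comment> \<open>Both \<open>u n\<close> and \<open>u m\<close> lie in the left translate of
    \<open>W\<close> by \<open>b\<close>, so \<open>u n\<close> is \<open>u m\<close> times an
    element of \<open>V\<close>; and \<open>m \<ge> l n\<close> makes \<open>u m\<close> a member of
    \<open>U (l n)\<close>, which \<open>lu\<close> excludes.\<close>
  obtain m v' where m: "m \<ge> l n" "v' \<in> W" "u m = b \<otimes> v'"
    using b(2) unfolding infinite_nat_iff_unbounded_le by blast
  have "u m \<in> U (l n)"
    using U_mono[OF m(1) u] .
  moreover have "inv v' \<otimes> v \<in> V"
    using W NB_inv m n by blast
  moreover have "u n = u m \<otimes> (inv v' \<otimes> v)"
    using b(1) m n act_NB_carrier[OF W(1)] by (simp add: m_assoc) (simp add: m_assoc[symmetric])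
  ultimately show False
    using lu by blast
qed

section \<open>Separability of the space\<close>

lemma finite_dopen_cover:
  assumes "V \<in> NB"
  obtains F where "finite F" "F \<subseteq> topspace X"
    "topspace X \<subseteq> (\<Union>x\<in>F. X interior_of (X closure_of ((\<lambda>g. act g x) ` V)))"
proof -
  let ?I = "\<lambda>x. X interior_of (X closure_of ((\<lambda>g. act g x) ` V))"
  have "\<forall>S\<in>?I ` topspace X. openin X S" "topspace X \<subseteq> \<Union>(?I ` topspace X)"
    using act_dopen[OF _ assms] by auto
  then obtain \<F> where \<F>: "finite \<F>" "\<F> \<subseteq> ?I ` topspace X" "topspace X \<subseteq> \<Union>\<F>"
    using compact unfolding compact_space_alt by meson
  obtain F where "F \<subseteq> topspace X" "finite F" "\<F> = ?I ` F"
    using finite_subset_image[OF \<F>(1,2)] by blast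
  then show thesis
    using that \<F>(3) by simp
qed

text \<open>The point \<open>d\<close> below is such that its orbit under \<open>K\<close>, in the sense of the preceding remark,
  meets the closure of \<open>O1\<close>.\<close>

lemma countable_orbit_dense:
  obtains D where "countable D" "D \<subseteq> topspace X"
    "\<And>O1 x. openin X O1 \<Longrightarrow> x \<in> O1 \<Longrightarrow> \<exists>d\<in>D. \<forall>l. \<exists>a\<in>U l. act a d \<in> O1"
proof -
  have "\<exists>F. finite F \<and> F \<subseteq> topspace X \<and>
      topspace X \<subseteq> (\<Union>x\<in>F. X interior_of (X closure_of ((\<lambda>g. act g x) ` U n)))" for n
    using finite_dopen_cover[OF U_NB[of n]] by metis
  then obtain F where F: "\<And>n. finite (F n)" "\<And>n. F n \<subseteq> topspace X"
    "\<And>n. topspace X \<subseteq> (\<Union>x\<in>F n. X interior_of (X closure_of ((\<lambda>g. act g x) ` U n)))"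
    by metis
  show thesis
  proof (rule that)
    show "countable (\<Union>n. F n)" "(\<Union>n. F n) \<subseteq> topspace X"
      using F by (auto intro: countable_finite)
    fix O1 x assume O1: "openin X O1" "x \<in> O1"
    obtain V O' where V: "V \<in> NB" "openin X O'" "x \<in> O'"
      "\<And>v y. v \<in> V \<Longrightarrow> y \<in> O' \<Longrightarrow> act v y \<in> O1"
      using joint[OF O1] by blast
    obtain n where n: "\<And>l u. u \<in> U n \<Longrightarrow> \<exists>a\<in>U l. \<exists>v\<in>V. u = a \<otimes> v"
      using U_absorb[OF V(1)] by blast
    have "x \<in> topspace X"
      using O1 openin_subset by blast
    then obtain d where d: "d \<in> F n" "x \<in> X interior_of (X closure_of ((\<lambda>g. act g d) ` U n))"
      using F(3)[of n] by blast
    then have "x \<in> X closure_of ((\<lambda>g. act g d) ` U n)"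
      using interior_of_subset by fast
    then obtain u where u: "u \<in> U n" "act u d \<in> O'"
      using closure_of_meets[OF _ V(2,3)] by blast
    have dX: "d \<in> topspace X"
      using d F(2) by blast
    have uG: "u \<in> carrier G"
      using u act_NB_carrier[OF U_NB] by blast
    have "\<exists>a\<in>U l. act a d \<in> O1" for l
    proof -
      \<comment> \<open>Absorption is applied to \<open>inv u\<close> because it leaves the small
        factor on the right; inverting gives \<open>inv a = v \<otimes> u\<close>, where
        \<open>v\<close> acts last. Only \<open>a\<close> and \<open>v\<close> depend on
        \<open>l\<close>, so the same \<open>d\<close> serves every \<open>l\<close>.\<close>
      obtain a v where av: "a \<in> U l" "v \<in> V" "inv u = a \<otimes> v"
        using n NB_inv[OF U_NB u(1)] by blast
      have G: "a \<in> carrier G" "v \<in> carrier G"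
        using av act_NB_carrier U_NB V(1) by blast+
      have "inv a = v \<otimes> u"
        using av(3) G uG
        by (metis inv_closed inv_inv inv_mult_group inv_solve_right m_closed)
      then have "act (inv a) d = act v (act u d)"
        using G uG dX by (simp add: act_mult)
      then show ?thesis
        using V(4) av u NB_inv[OF U_NB] by metis
    qed
    then show "\<exists>d\<in>(\<Union>n. F n). \<forall>l. \<exists>a\<in>U l. act a d \<in> O1"
      using d by blast
  qed
qed

text \<open>\<open>E\<close> is fixed before \<open>V\<close>, \<open>O1\<close> and
  \<open>O2\<close>: it consists of the points \<open>f d\<close> with \<open>f\<close> in finite
  sets \<open>F m\<close> whose translates of \<open>V m\<close> cover \<open>U (n m)\<close>. If
  \<open>u m\<close> brings \<open>d\<close> into \<open>O1\<close>, the centre \<open>f\<close> of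
  a translate containing \<open>u m\<close> does nearly the same for suitable \<open>m\<close>; the
  two factors \<open>v\<close> and \<open>w\<close> measure the room lost.\<close>

lemma orbit_separable:
  assumes d: "d \<in> topspace X"
  shows "\<exists>E. countable E \<and> E \<subseteq> topspace X \<and>
    (\<forall>V\<in>NB. \<forall>O1 O2. openin X O1 \<longrightarrow> (\<forall>l. \<exists>a\<in>U l. act a d \<in> O1) \<longrightarrow>
       (\<forall>v\<in>V. \<forall>w\<in>V. \<forall>y\<in>O1. act v (act w y) \<in> O2) \<longrightarrow> (\<exists>e\<in>E. e \<in> O2))"
proof -
  obtain B where B: "\<And>n. openin X (B n)" "\<And>n. d \<in> B n" "decseq B"
    "\<And>S. openin X S \<Longrightarrow> d \<in> S \<Longrightarrow> \<exists>n. B n \<subseteq> S"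
    using first_countable_decreasing_base[OF first_countable d] by blast
  have "\<forall>m. \<exists>V\<in>NB. \<forall>v\<in>V. act v d \<in> B m"
    using act_near B(1,2) by blast
  then obtain V where V: "\<And>m. V m \<in> NB" "\<And>m v. v \<in> V m \<Longrightarrow> act v d \<in> B m"
    by metis
  have "\<forall>m. \<exists>n F. finite F \<and> F \<subseteq> carrier G \<and> U n \<subseteq> (\<Union>f\<in>F. f <# V m)"
    using U_total[OF V(1)] by blast
  then obtain n F where F: "\<And>m. finite (F m)" "\<And>m. F m \<subseteq> carrier G"
    "\<And>m. U (n m) \<subseteq> (\<Union>f\<in>F m. f <# V m)"
    by metis
  show ?thesis
  proof (intro exI conjI ballI allI impI)
    let ?E = "\<Union>m. (\<lambda>f. act f d) ` F m"
    show "countable ?E"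
      by (intro countable_UN countable_image) (auto intro: countable_finite F(1))
    show "?E \<subseteq> topspace X"
      using F(2) act_closed[OF _ d] by auto
    fix W O1 O2
    assume W: "W \<in> NB" and O1: "openin X O1" and meet: "\<forall>l. \<exists>a\<in>U l. act a d \<in> O1"
      and O2: "\<forall>v\<in>W. \<forall>w\<in>W. \<forall>y\<in>O1. act v (act w y) \<in> O2"
    \<comment> \<open>An index of at least \<open>m\<close> serves the pigeonhole lemma; an index of
      at least \<open>n m\<close> puts the term into a translate with centre in
      \<open>F m\<close>.\<close>
    have "\<forall>m. \<exists>a. a \<in> U (max m (n m)) \<and> act a d \<in> O1"
      using meet by blast
    then obtain u where u: "\<And>m. u m \<in> U (max m (n m))" "\<And>m. act (u m) d \<in> O1"
      by metis
    have u1: "u m \<in> U m" and u2: "u m \<in> U (n m)" for m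
      using U_mono[OF _ u(1)] by simp_all
    have uG: "u m \<in> carrier G" for m
      using u1 act_NB_carrier U_NB by blast
    obtain b where b: "b \<in> carrier G" "infinite {m. \<exists>w\<in>W. u m = w \<otimes> b}"
      using pigeonhole_right[OF u1 W] .
    from infinite_imp_nonempty[OF b(2)] obtain k w where k: "w \<in> W" "u k = w \<otimes> b"
      by blast
    have wG: "w \<in> carrier G"
      using k W act_NB_carrier by blast
    \<comment> \<open>The fixed term \<open>u k = w \<otimes> b\<close> acts as a single continuous
      map, so it carries a whole base set \<open>B j\<close> at \<open>d\<close> into
      \<open>O1\<close>.\<close>
    have "openin X {x \<in> topspace X. act w (act b x) \<in> O1}"
    proof -
      have "{x \<in> topspace X. act w (act b x) \<in> O1} =
          {x \<in> topspace X. act (w \<otimes> b) x \<in> O1}"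
        using wG b(1) by (auto simp: act_mult)
      then show ?thesis
        using act_preimage_open[OF _ O1, of "w \<otimes> b"] wG b(1) by simp
    qed
    moreover have "act w (act b d) \<in> O1"
      using u(2)[of k] k wG b(1) d by (simp add: act_mult)
    ultimately obtain j where j: "B j \<subseteq> {x \<in> topspace X. act w (act b x) \<in> O1}"
      using B(4) d by blast
    obtain m w' where m: "m \<ge> j" "w' \<in> W" "u m = w' \<otimes> b"
      using b(2) unfolding infinite_nat_iff_unbounded_le by blast
    have w'G: "w' \<in> carrier G"
      using m W act_NB_carrier by blast
    obtain f v where f: "f \<in> F m" "v \<in> V m" "u m = f \<otimes> v"
      using u2[of m] F(3)[of m] by (auto simp: l_coset_def)
    have fG: "f \<in> carrier G" "v \<in> carrier G"
      using f F(2) V(1) act_NB_carrier by blast+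
    \<comment> \<open>Since \<open>u m = f \<otimes> v\<close>, the point \<open>f d\<close> is
      \<open>u m\<close> applied to \<open>z\<close>; symmetry of \<open>V m\<close> keeps
      \<open>z\<close> in \<open>B m\<close>, which lies in \<open>B j\<close>.\<close>
    define z where "z = act (inv v) d"
    have z: "z \<in> B m"
      using V(2) NB_inv[OF V(1) f(2)] by (auto simp: z_def)
    then have zj: "act w (act b z) \<in> O1" "z \<in> topspace X"
      using j m(1) B(3) by (auto simp: decseq_def)
    have "f = u m \<otimes> inv v"
      using f(3) fG by (simp add: inv_solve_right)
    then have "act f d = act (u m) z"
      using fG uG d by (simp add: act_mult z_def)
    also have "\<dots> = act w' (act b z)"
      using m(3) w'G b(1) zj by (simp add: act_mult)
    \<comment> \<open>The factor \<open>w\<close> of the fixed term is inserted because it is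
      \<open>w b z\<close> that is known to be in \<open>O1\<close>. The two factors from
      \<open>W\<close> are spent here, as \<open>w'\<close> and \<open>inv w\<close>.\<close>
    also have "act b z = act (inv w) (act w (act b z))"
      using wG b(1) zj by (simp add: act_inv_left act_closed)
    finally have "act f d \<in> O2"
      using O2 m(2) NB_inv[OF W k(1)] zj(1) by simp
    then show "\<exists>e\<in>?E. e \<in> O2"
      using f(1) by blast
  qed
qed

text \<open>For each \<open>d\<close> the set \<open>E d\<close> handles the open sets approached by
  the orbit of \<open>d\<close>, and countably many \<open>d\<close> suffice. Applying
  \<open>joint\<close> twice makes room for the two factors that \<open>orbit_separable\<close>
  loses.\<close>

lemma countable_dense:
  obtains E where "countable E" "E \<subseteq> topspace X"
    "\<And>O1 x. openin X O1 \<Longrightarrow> x \<in> O1 \<Longrightarrow> \<exists>e\<in>E. e \<in> O1"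
proof -
  obtain D where D: "countable D" "D \<subseteq> topspace X"
    "\<And>O1 x. openin X O1 \<Longrightarrow> x \<in> O1 \<Longrightarrow> \<exists>d\<in>D. \<forall>l. \<exists>a\<in>U l. act a d \<in> O1"
    using countable_orbit_dense by blast
  have "\<forall>d\<in>D. \<exists>E. countable E \<and> E \<subseteq> topspace X \<and>
    (\<forall>V\<in>NB. \<forall>O1 O2. openin X O1 \<longrightarrow> (\<forall>l. \<exists>a\<in>U l. act a d \<in> O1) \<longrightarrow>
       (\<forall>v\<in>V. \<forall>w\<in>V. \<forall>y\<in>O1. act v (act w y) \<in> O2) \<longrightarrow> (\<exists>e\<in>E. e \<in> O2))"
    using D(2) by (intro ballI orbit_separable) auto
  from bchoice[OF this] obtain E where E: "\<forall>d\<in>D. countable (E d) \<and> E d \<subseteq> topspace X \<and>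
    (\<forall>V\<in>NB. \<forall>O1 O2. openin X O1 \<longrightarrow> (\<forall>l. \<exists>a\<in>U l. act a d \<in> O1) \<longrightarrow>
       (\<forall>v\<in>V. \<forall>w\<in>V. \<forall>y\<in>O1. act v (act w y) \<in> O2) \<longrightarrow> (\<exists>e\<in>E d. e \<in> O2))" ..
  show thesis
  proof (rule that)
    show "countable (\<Union>d\<in>D. E d)" "(\<Union>d\<in>D. E d) \<subseteq> topspace X"
      using D E by auto
    fix O2 x assume O2: "openin X O2" "x \<in> O2"
    obtain V O1 where V: "V \<in> NB" "openin X O1" "x \<in> O1"
      "\<And>v y. v \<in> V \<Longrightarrow> y \<in> O1 \<Longrightarrow> act v y \<in> O2"
      using joint[OF O2] by blast
    obtain V' O0 where V': "V' \<in> NB" "openin X O0" "x \<in> O0"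
      "\<And>v y. v \<in> V' \<Longrightarrow> y \<in> O0 \<Longrightarrow> act v y \<in> O1"
      using joint[OF V(2,3)] by blast
    obtain Z where Z: "Z \<in> NB" "Z \<subseteq> V \<inter> V'"
      using NB_Int V(1) V'(1) by blast
    obtain d where d: "d \<in> D" "\<forall>l. \<exists>a\<in>U l. act a d \<in> O0"
      using D(3)[OF V'(2,3)] by blast
    have "\<exists>e\<in>E d. e \<in> O2"
    proof (rule E[rule_format, THEN conjunct2, THEN conjunct2, rule_format, OF d(1) Z(1) V'(2)])
      show "\<exists>a\<in>U l. act a d \<in> O0" for l
        using d(2) by blast
      fix v w y assume "v \<in> Z" "w \<in> Z" "y \<in> O0"
      then show "act v (act w y) \<in> O2"
        using V(4)[OF _ V'(4)] Z(2) by blast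
    qed
    then show "\<exists>e\<in>(\<Union>d\<in>D. E d). e \<in> O2"
      using d by blast
  qed
qed

section \<open>Neighbourhoods contracting at every point, and a countable base\<close>

lemma refining_sequence:
  assumes E: "countable E" "E \<subseteq> topspace X"
  obtains W :: "nat \<Rightarrow> 'a set" where "\<And>n. W n \<in> NB" "\<And>n. W n \<subseteq> U n"
    "\<And>n a b. a \<in> W (Suc n) \<Longrightarrow> b \<in> W (Suc n) \<Longrightarrow> a \<otimes> b \<in> W n"
    "\<And>e O1. e \<in> E \<Longrightarrow> openin X O1 \<Longrightarrow> e \<in> O1 \<Longrightarrow> \<exists>n. \<forall>w\<in>W n. act w e \<in> O1"
proof -
  have "\<forall>e\<in>E. \<exists>V. \<forall>m::nat. V m \<in> NB \<and>
      (\<forall>O1. openin X O1 \<longrightarrow> e \<in> O1 \<longrightarrow> (\<exists>m. \<forall>v\<in>V m. act v e \<in> O1))"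
  proof
    fix e assume "e \<in> E"
    then have "e \<in> topspace X"
      using E(2) by blast
    then obtain B where B: "\<And>n::nat. openin X (B n)" "\<And>n. e \<in> B n"
      "\<And>S. openin X S \<Longrightarrow> e \<in> S \<Longrightarrow> \<exists>n. B n \<subseteq> S"
      using first_countable_decreasing_base[OF first_countable] by metis
    have "\<forall>m. \<exists>V\<in>NB. \<forall>v\<in>V. act v e \<in> B m"
      using act_near B(1,2) by blast
    then obtain V where V: "\<forall>m. V m \<in> NB \<and> (\<forall>v\<in>V m. act v e \<in> B m)"
      by metis
    have "\<exists>m. \<forall>v\<in>V m. act v e \<in> O1" if "openin X O1" "e \<in> O1" for O1
      using B(3)[OF that] V by fast
    with V show "\<exists>V. \<forall>m::nat. V m \<in> NB \<and>
      (\<forall>O1. openin X O1 \<longrightarrow> e \<in> O1 \<longrightarrow> (\<exists>m. \<forall>v\<in>V m. act v e \<in> O1))"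
      by (intro exI[of _ V]) simp
  qed
  then obtain V where V: "\<And>e m::nat. e \<in> E \<Longrightarrow> V e m \<in> NB"
    "\<And>e O1. e \<in> E \<Longrightarrow> openin X O1 \<Longrightarrow> e \<in> O1 \<Longrightarrow> \<exists>m. \<forall>v\<in>V e m. act v e \<in> O1"
    by metis
  \<comment> \<open>The sets \<open>V e m\<close> express all contraction requirements at points of
    \<open>E\<close>; there are countably many, so they can be enumerated as \<open>q\<close> and
    met one at a time. The member \<open>U 0\<close> keeps the family nonempty even if
    \<open>E\<close> is empty.\<close>
  define \<Q> where "\<Q> = insert (U 0) (\<Union>e\<in>E. range (V e))"
  have Q: "countable \<Q>" "\<Q> \<noteq> {}" "\<Q> \<subseteq> NB"
    using E(1) V(1) U_NB by (auto simp: \<Q>_def)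
  define q where "q = from_nat_into \<Q>"
  have q: "range q = \<Q>"
    using Q by (simp add: q_def range_from_nat_into)
  have qNB: "q n \<in> NB" for n
    using q Q(3) by blast
  have meet: "\<exists>W\<in>NB. W \<subseteq> U n \<inter> q n" for n
    using NB_Int U_NB qNB by blast
  have "\<exists>W. \<forall>n. (W n \<in> NB \<and> W n \<subseteq> U n \<inter> q n) \<and>
      (\<forall>a\<in>W (Suc n). \<forall>b\<in>W (Suc n). a \<otimes> b \<in> W n)"
  proof (rule dependent_nat_choice)
    show "\<exists>W. W \<in> NB \<and> W \<subseteq> U 0 \<inter> q 0"
      using meet by blast
    fix W n assume W: "W \<in> NB \<and> W \<subseteq> U n \<inter> q n"
    obtain W1 where W1: "W1 \<in> NB" "\<forall>a\<in>W1. \<forall>b\<in>W1. a \<otimes> b \<in> W"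
      using NB_square W by blast
    obtain W2 where W2: "W2 \<in> NB" "W2 \<subseteq> U (Suc n) \<inter> q (Suc n)"
      using meet by blast
    obtain Z where "Z \<in> NB" "Z \<subseteq> W1 \<inter> W2"
      using NB_Int W1(1) W2(1) by blast
    then show "\<exists>Z. (Z \<in> NB \<and> Z \<subseteq> U (Suc n) \<inter> q (Suc n)) \<and> (\<forall>a\<in>Z. \<forall>b\<in>Z. a \<otimes> b \<in> W)"
      using W1 W2 by blast
  qed
  then obtain W where W: "\<And>n. W n \<in> NB" "\<And>n. W n \<subseteq> U n \<inter> q n"
    "\<And>n a b. a \<in> W (Suc n) \<Longrightarrow> b \<in> W (Suc n) \<Longrightarrow> a \<otimes> b \<in> W n"
    by blast
  show thesis
  proof (rule that[OF W(1) _ W(3)])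
    show "W n \<subseteq> U n" for n
      using W(2) by blast
    fix e O1 assume e: "e \<in> E" "openin X O1" "e \<in> O1"
    then obtain m where m: "\<forall>v\<in>V e m. act v e \<in> O1"
      using V(2) by blast
    obtain n where "q n = V e m"
      using e(1) q by (metis (no_types, lifting) UN_I \<Q>_def insertCI rangeE rangeI)
    then show "\<exists>n. \<forall>w\<in>W n. act w e \<in> O1"
      using m W(2) by blast
  qed auto
qed

text \<open>Total boundedness takes the place of equicontinuity. If elements \<open>w n\<close> keep
  moving \<open>x\<close> out of \<open>O1\<close>, infinitely many of them are \<open>b\<close> up
  to a small left factor, so \<open>b\<close> moves \<open>x\<close> away as well. Then
  \<open>b\<close> also moves away a nearby \<open>e\<close> in \<open>E\<close>, although the
  \<open>w m\<close> hardly move \<open>e\<close>.\<close>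

lemma near_on_dense_imp_near:
  assumes W: "\<And>n. W n \<in> NB" "\<And>n. W n \<subseteq> U n" "decseq W"
    and E: "E \<subseteq> topspace X" "\<And>O1 x. openin X O1 \<Longrightarrow> x \<in> O1 \<Longrightarrow> \<exists>e\<in>E. e \<in> O1"
    and near: "\<And>e O1. e \<in> E \<Longrightarrow> openin X O1 \<Longrightarrow> e \<in> O1 \<Longrightarrow> \<exists>n. \<forall>w\<in>W n. act w e \<in> O1"
    and O1: "openin X O1" "x \<in> O1"
  shows "\<exists>n. \<forall>w\<in>W n. act w x \<in> O1"
proof (rule ccontr)
  assume "\<not> ?thesis"
  then obtain w where w: "\<And>n. w n \<in> W n" "\<And>n. act (w n) x \<notin> O1"
    by metis
  have wU: "w n \<in> U n" for n
    using w(1) W(2) by blast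
  have xX: "x \<in> topspace X"
    using O1 openin_subset by blast
  obtain V1 P where V1: "V1 \<in> NB" "openin X P" "x \<in> P"
    "\<And>v y. v \<in> V1 \<Longrightarrow> y \<in> P \<Longrightarrow> act v y \<in> O1"
    using joint[OF O1] by blast
  \<comment> \<open>The gap between \<open>P2\<close> and \<open>P\<close> turns leaving
    \<open>P\<close> into an open condition: being mapped by \<open>b\<close> outside the closure of
    \<open>P2\<close> passes from \<open>x\<close> to a nearby point of \<open>E\<close>.\<close>
  obtain P2 where P2: "openin X P2" "x \<in> P2" "X closure_of P2 \<subseteq> P"
    using compact_Hausdorff_shrink[OF compact Hausdorff V1(2,3)] .
  obtain V3 P3 where V3: "V3 \<in> NB" "openin X P3" "x \<in> P3"
    "\<And>v y. v \<in> V3 \<Longrightarrow> y \<in> P3 \<Longrightarrow> act v y \<in> P2"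
    using joint[OF P2(1,2)] by blast
  obtain V where V: "V \<in> NB" "V \<subseteq> V1 \<inter> V3"
    using NB_Int V1(1) V3(1) by blast
  obtain b where b: "b \<in> carrier G" "infinite {m. \<exists>v\<in>V. w m = v \<otimes> b}"
    using pigeonhole_right[OF wU V(1)] .
  from infinite_imp_nonempty[OF b(2)] obtain k v where k: "v \<in> V" "w k = v \<otimes> b"
    by blast
  have "act (w k) x = act v (act b x)"
    using k b(1) xX act_NB_carrier[OF V(1)] by (simp add: act_mult)
  then have "act b x \<notin> P"
    using V1(4) V(2) k(1) w(2) by (metis IntD1 subsetD)
  then have "act b x \<in> topspace X - X closure_of P2"
    using P2(3) act_closed b(1) xX by blast
  moreover have "openin X {y \<in> topspace X. act b y \<in> topspace X - X closure_of P2}"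
    by (intro act_preimage_open[OF b(1)] openin_diff) auto
  ultimately have "openin X (P3 \<inter> {y \<in> topspace X. act b y \<in> topspace X - X closure_of P2})"
    "x \<in> P3 \<inter> {y \<in> topspace X. act b y \<in> topspace X - X closure_of P2}"
    using V3 xX by (auto intro: openin_Int)
  from E(2)[OF this] obtain e where e: "e \<in> E" "e \<in> P3" "act b e \<notin> X closure_of P2"
    by blast
  have eX: "e \<in> topspace X"
    using e E(1) by blast
  \<comment> \<open>Here \<open>e\<close> depends on \<open>b\<close>, and \<open>n\<close> on
    \<open>e\<close>; since infinitely many terms share \<open>b\<close>, one of them has index at
    least \<open>n\<close>.\<close>
  obtain n where n: "\<forall>w\<in>W n. act w e \<in> P3"
    using near[OF e(1) V3(2) e(2)] by blast
  obtain m v' where m: "m \<ge> n" "v' \<in> V" "w m = v' \<otimes> b"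
    using b(2) unfolding infinite_nat_iff_unbounded_le by blast
  have v'G: "v' \<in> carrier G"
    using m(2) act_NB_carrier[OF V(1)] by blast
  have "w m \<in> W n"
    using w(1)[of m] decseqD[OF W(3) m(1)] by blast
  then have "act (w m) e \<in> P3"
    using n by blast
  moreover have "inv v' \<in> V3"
    using NB_inv[OF V(1) m(2)] V(2) by blast
  ultimately have "act (inv v') (act (w m) e) \<in> P2"
    using V3(4) by blast
  moreover have "act (inv v') (act (w m) e) = act b e"
    using m(3) v'G b(1) eX act_inv_left[OF v'G act_closed[OF b(1) eX]] by (simp add: act_mult)
  ultimately have "act b e \<in> X closure_of P2"
    using closure_of_subset[of P2 X] P2(1) openin_subset by (metis subsetD)
  then show False
    using e(3) by blast
qed

theorem metrizable: "metrizable_space X"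
proof (rule compact_Hausdorff_second_countable_imp_metrizable[OF compact Hausdorff])
  obtain E where E: "countable E" "E \<subseteq> topspace X"
    "\<And>O1 x. openin X O1 \<Longrightarrow> x \<in> O1 \<Longrightarrow> \<exists>e\<in>E. e \<in> O1"
    using countable_dense by blast
  obtain W :: "nat \<Rightarrow> 'a set" where W: "\<And>n. W n \<in> NB" "\<And>n. W n \<subseteq> U n"
    "\<And>n a b. a \<in> W (Suc n) \<Longrightarrow> b \<in> W (Suc n) \<Longrightarrow> a \<otimes> b \<in> W n"
    "\<And>e O1. e \<in> E \<Longrightarrow> openin X O1 \<Longrightarrow> e \<in> O1 \<Longrightarrow> \<exists>n. \<forall>w\<in>W n. act w e \<in> O1"
    using refining_sequence[OF E(1,2)] by blast
  have WG: "w \<in> carrier G" if "w \<in> W n" for w n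
    using that act_NB_carrier W(1) by blast
  have "W (Suc n) \<subseteq> W n" for n
  proof
    fix w assume "w \<in> W (Suc n)"
    then show "w \<in> W n"
      using W(3)[of w n \<one>] NB_one[OF W(1)] WG by force
  qed
  then have dec: "decseq W"
    by (rule decseq_SucI)
  let ?I = "\<lambda>n x. X interior_of (X closure_of ((\<lambda>g. act g x) ` W n))"
  have "\<forall>n. \<exists>F. finite F \<and> F \<subseteq> topspace X \<and> topspace X \<subseteq> (\<Union>x\<in>F. ?I n x)"
    using finite_dopen_cover[OF W(1)] by metis
  then obtain F where F: "\<And>n. finite (F n)" "\<And>n. F n \<subseteq> topspace X"
    "\<And>n. topspace X \<subseteq> (\<Union>x\<in>F n. ?I n x)"
    by metis
  show "second_countable X"
    unfolding second_countable_def
  proof (intro exI conjI ballI allI impI)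
    let ?B = "\<Union>n. ?I n ` F n"
    show "countable ?B"
      using F(1) by (auto intro: countable_finite)
    show "openin X V" if "V \<in> ?B" for V
      using that by auto
    fix O1 x assume "openin X O1 \<and> x \<in> O1"
    then obtain O0 where O0: "openin X O0" "x \<in> O0" "X closure_of O0 \<subseteq> O1"
      using compact_Hausdorff_shrink[OF compact Hausdorff] by metis
    obtain A where A: "openin X A" "x \<in> A" "X closure_of A \<subseteq> O0"
      using compact_Hausdorff_shrink[OF compact Hausdorff O0(1,2)] .
    have "\<exists>n. \<forall>w\<in>W n. act w x \<in> A"
      by (rule near_on_dense_imp_near[of W E]) (fact W dec E A)+
    then obtain n where n: "\<And>w. w \<in> W n \<Longrightarrow> act w x \<in> A"
      by blast
    have xX: "x \<in> topspace X"
      using A openin_subset by blast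
    obtain O' where O': "openin X O'" "x \<in> O'"
      "\<And>w y. w \<in> W (Suc n) \<Longrightarrow> y \<in> O' \<Longrightarrow> act w y \<in> X closure_of A"
      using joint_closure[of "W (Suc n)" "W n" x A, OF W(1) W(3) xX n] by blast
    \<comment> \<open>Two halvings are spent: from \<open>W n\<close> to \<open>W (Suc n)\<close> in
      \<open>joint_closure\<close>, and from \<open>W (Suc n)\<close> to \<open>W ?k\<close> for the
      products \<open>v \<otimes> inv w\<close> below.\<close>
    let ?k = "Suc (Suc n)"
    obtain f where f: "f \<in> F ?k" "x \<in> ?I ?k f"
      using F(3)[of ?k] xX by blast
    then have "x \<in> X closure_of ((\<lambda>g. act g f) ` W ?k)"
      using interior_of_subset by fast
    then obtain w where w: "w \<in> W ?k" "act w f \<in> O'"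
      using closure_of_meets[OF _ O'(1,2)] by blast
    have fX: "f \<in> topspace X"
      using f F(2) by blast
    \<comment> \<open>The element \<open>w\<close> brings \<open>f\<close> close to
      \<open>x\<close>; every other point \<open>v f\<close> of the orbit piece is
      \<open>v \<otimes> inv w\<close> applied to \<open>w f\<close>, hence stays in
      \<open>O0\<close>.\<close>
    have "(\<lambda>g. act g f) ` W ?k \<subseteq> O0"
    proof clarify
      fix v assume v: "v \<in> W ?k"
      have "v \<otimes> inv w \<in> W (Suc n)"
        using W(3) v NB_inv[OF W(1) w(1)] by blast
      then have "act (v \<otimes> inv w) (act w f) \<in> O0"
        using O'(3) w(2) A(3) by blast
      moreover have "act (v \<otimes> inv w) (act w f) = act v f"
        using WG[OF v] WG[OF w(1)] fX by (simp add: act_mult m_assoc)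
      ultimately show "act v f \<in> O0"
        by simp
    qed
    then have "?I ?k f \<subseteq> O1"
      using O0(3) closure_of_mono[of _ O0 X] interior_of_subset by (meson order_trans)
    then show "\<exists>V\<in>?B. x \<in> V \<and> V \<subseteq> O1"
      using f by blast
  qed
qed

end

section \<open>Cech-complete groups\<close>

definition sym_nbhd :: "('a, 'b) monoid_scheme \<Rightarrow> 'a topology \<Rightarrow> 'a set \<Rightarrow> bool" where
  "sym_nbhd G T B \<longleftrightarrow> openin T B \<and> \<one>\<^bsub>G\<^esub> \<in> B \<and> (\<forall>x\<in>B. inv\<^bsub>G\<^esub> x \<in> B)"

context
  fixes G :: "('a, 'b) monoid_scheme" (structure) and T :: "'a topology"
  assumes TG: "topological_group G T"
begin

interpretation group G
  using TG by (simp add: topological_group_def)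

section \<open>Translations and symmetric neighbourhoods in a topological group\<close>

lemma topspace_eq: "topspace T = carrier G"
  using TG by (simp add: topological_group_def)

lemma left_translation_continuous:
  assumes "a \<in> carrier G" shows "continuous_map T T (\<lambda>x. a \<otimes> x)"
proof -
  have "continuous_map T (prod_topology T T) (\<lambda>x. (a, x))"
    using assms by (simp add: continuous_map_pairedI topspace_eq)
  moreover have "continuous_map (prod_topology T T) T (\<lambda>(x, y). x \<otimes> y)"
    using TG by (simp add: topological_group_def)
  ultimately show ?thesis
    using continuous_map_compose by (fastforce simp: o_def)
qed

lemma right_translation_continuous:
  assumes "a \<in> carrier G" shows "continuous_map T T (\<lambda>x. x \<otimes> a)"
proof -
  have "continuous_map T (prod_topology T T) (\<lambda>x. (x, a))"
    using assms by (simp add: continuous_map_pairedI topspace_eq)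
  moreover have "continuous_map (prod_topology T T) T (\<lambda>(x, y). x \<otimes> y)"
    using TG by (simp add: topological_group_def)
  ultimately show ?thesis
    using continuous_map_compose by (fastforce simp: o_def)
qed

lemma sym_nbhd_shrink:
  assumes B: "openin T B" "\<one> \<in> B"
  shows "\<exists>B'\<subseteq>B. sym_nbhd G T B'"
proof (intro exI conjI)
  let ?B = "B \<inter> {x \<in> topspace T. inv x \<in> B}"
  have "continuous_map T T (\<lambda>x. inv x)"
    using TG by (simp add: topological_group_def)
  then have "openin T ?B"
    using B by (intro openin_Int openin_continuous_map_preimage)
  then show "sym_nbhd G T ?B"
    using B openin_subset[OF B(1)] by (auto simp: sym_nbhd_def topspace_eq)
qed auto

lemma sym_nbhd_square:
  assumes B: "openin T B" "\<one> \<in> B"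
  shows "\<exists>B'. sym_nbhd G T B' \<and> (\<forall>x\<in>B'. \<forall>y\<in>B'. x \<otimes> y \<in> B)"
proof -
  have "continuous_map (prod_topology T T) T (\<lambda>(x, y). x \<otimes> y)"
    using TG by (simp add: topological_group_def)
  then have "openin (prod_topology T T)
      {p \<in> topspace (prod_topology T T). (\<lambda>(x, y). x \<otimes> y) p \<in> B}"
    using B(1) by (rule openin_continuous_map_preimage)
  moreover have "(\<one>, \<one>) \<in> {p \<in> topspace (prod_topology T T). (\<lambda>(x, y). x \<otimes> y) p \<in> B}"
    using B(2) by (simp add: topspace_eq)
  ultimately obtain C D where CD: "openin T C" "openin T D" "\<one> \<in> C" "\<one> \<in> D"
    "C \<times> D \<subseteq> {p \<in> topspace (prod_topology T T). (\<lambda>(x, y). x \<otimes> y) p \<in> B}"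
    unfolding openin_prod_topology_alt by meson
  obtain B' where B': "B' \<subseteq> C \<inter> D" "sym_nbhd G T B'"
    using sym_nbhd_shrink[of "C \<inter> D"] CD by auto
  have "x \<otimes> y \<in> B" if "x \<in> B'" "y \<in> B'" for x y
    using subsetD[OF CD(5), of "(x, y)"] that B'(1) by auto
  then show ?thesis
    using B'(2) by blast
qed

lemma sym_nbhd_conj:
  assumes B: "openin T B" "\<one> \<in> B" and a: "a \<in> carrier G"
  shows "\<exists>B'. sym_nbhd G T B' \<and> (\<forall>x\<in>B'. inv a \<otimes> x \<otimes> a \<in> B)"
proof -
  have "continuous_map T T ((\<lambda>x. x \<otimes> a) \<circ> (\<lambda>x. inv a \<otimes> x))"
    using a by (intro continuous_map_compose[of T T] left_translation_continuous
        right_translation_continuous inv_closed)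
  then have "openin T {x \<in> topspace T. ((\<lambda>x. x \<otimes> a) \<circ> (\<lambda>x. inv a \<otimes> x)) x \<in> B}"
    using B(1) by (rule openin_continuous_map_preimage)
  moreover have "\<one> \<in> {x \<in> topspace T. ((\<lambda>x. x \<otimes> a) \<circ> (\<lambda>x. inv a \<otimes> x)) x \<in> B}"
    using a B(2) by (simp add: topspace_eq)
  ultimately show ?thesis
    using sym_nbhd_shrink by fastforce
qed

lemma l_coset_open:
  assumes "openin T V" "a \<in> carrier G" shows "openin T (a <# V)"
proof -
  have "a <# V = {x \<in> topspace T. inv a \<otimes> x \<in> V}"
  proof (intro equalityI subsetI)
    fix x assume "x \<in> a <# V"
    then show "x \<in> {x \<in> topspace T. inv a \<otimes> x \<in> V}"
      using assms openin_subset[OF assms(1)]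
      by (auto simp: l_coset_def topspace_eq m_assoc[symmetric])
  next
    fix x assume x: "x \<in> {x \<in> topspace T. inv a \<otimes> x \<in> V}"
    then have "x = a \<otimes> (inv a \<otimes> x)"
      using assms by (simp add: topspace_eq m_assoc[symmetric])
    then show "x \<in> a <# V"
      using x by (auto simp: l_coset_def)
  qed
  then show ?thesis
    using openin_continuous_map_preimage[OF left_translation_continuous assms(1)] assms(2) by simp
qed

text \<open>A \<open>G\<close>-delta set in a compact space contains, around each of its points, a
  compact set that is the intersection of a shrinking sequence of neighbourhoods. Around the unit,
  finitely many translates of \<open>V\<close> cover this compact set, hence also some member of the
  sequence.\<close>

lemma cech_complete_totally_bounded_nbhds:
  assumes cech: "cech_complete TYPE('k) T"
  shows "\<exists>U :: nat \<Rightarrow> 'a set. (\<forall>n. sym_nbhd G T (U n)) \<and> decseq U \<and>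
    (\<forall>V. openin T V \<longrightarrow> \<one> \<in> V \<longrightarrow>
      (\<exists>n F. finite F \<and> F \<subseteq> carrier G \<and> U n \<subseteq> (\<Union>f\<in>F. f <# V)))"
proof -
  obtain K :: "'k topology" and A where K: "compact_space K" "Hausdorff_space K"
    "A \<subseteq> topspace K" "gdelta_in K A" "T homeomorphic_space subtopology K A"
    using cech unfolding cech_complete_def by blast
  obtain f g where fg: "homeomorphic_maps T (subtopology K A) f g"
    using K(5) unfolding homeomorphic_space_def by blast
  have f_cont: "continuous_map T K f" and fA: "f ` topspace T \<subseteq> A"
    using fg by (auto simp: homeomorphic_maps_def continuous_map_in_subtopology)
  have top_A: "topspace (subtopology K A) = A"
    using K(3) by auto
  have gf: "g (f x) = x" if "x \<in> topspace T" for x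
    using fg that by (simp add: homeomorphic_maps_def)
  have fg': "f (g y) = y" and gT: "g y \<in> topspace T" if "y \<in> A" for y
    using fg that top_A by (auto simp: homeomorphic_maps_def continuous_map_def)
  have f_open: "open_map T (subtopology K A) f"
    using fg by (simp add: homeomorphic_maps_map homeomorphic_imp_open_map)
  obtain C :: "nat \<Rightarrow> 'k set" where C: "\<forall>n. openin K (C n)" "\<Inter>(range C) = A"
    using gdelta_in_descending[THEN iffD1, OF K(4)] by blast
  have p: "f \<one> \<in> A" "f \<one> \<in> topspace K"
    using fA K(3) topspace_eq one_closed by auto
  \<comment> \<open>Each closure enters the previous set and one more \<open>C n\<close>, so the
    intersection of all closures is a compact subset of \<open>A\<close>, the copy of the group in
    \<open>K\<close>.\<close>
  have "\<exists>W. \<forall>n. (openin K (W n) \<and> f \<one> \<in> W n) \<and> K closure_of (W (Suc n)) \<subseteq> W n \<inter> C n"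
  proof (rule dependent_nat_choice)
    show "\<exists>W. openin K W \<and> f \<one> \<in> W"
      using p by blast
    fix W n assume "openin K W \<and> f \<one> \<in> W"
    then have "openin K (W \<inter> C n)" "f \<one> \<in> W \<inter> C n"
      using C p(1) by auto
    then show "\<exists>W'. (openin K W' \<and> f \<one> \<in> W') \<and> K closure_of W' \<subseteq> W \<inter> C n"
      using compact_Hausdorff_shrink[OF K(1,2)] by metis
  qed
  then obtain W where W: "\<And>n. openin K (W n)" "\<And>n. f \<one> \<in> W n"
    "\<And>n. K closure_of (W (Suc n)) \<subseteq> W n \<inter> C n"
    by blast
  have W_cl: "W n \<subseteq> K closure_of W n" for n
    using W(1) by (simp add: closure_of_subset openin_subset)
  have W_dec: "decseq W"
    using W(3) W_cl by (intro decseq_SucI) blast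
  define U' where "U' n = {x \<in> topspace T. f x \<in> W n}" for n
  have U'_open: "openin T (U' n)" for n
    unfolding U'_def using f_cont W(1) by (rule openin_continuous_map_preimage)
  define U where "U n = U' n \<inter> {x \<in> topspace T. inv x \<in> U' n}" for n
  have inv_cont: "continuous_map T T (\<lambda>x. inv x)"
    using TG by (simp add: topological_group_def)
  have U_sym: "sym_nbhd G T (U n)" for n
  proof -
    have "openin T (U n)"
      unfolding U_def using U'_open inv_cont by (intro openin_Int openin_continuous_map_preimage)
    then show ?thesis
      using W(2) by (auto simp: sym_nbhd_def U_def U'_def topspace_eq)
  qed
  have U_dec: "decseq U"
    using decseqD[OF W_dec] by (fastforce simp: decseq_def U_def U'_def)
  have total: "\<exists>n F. finite F \<and> F \<subseteq> carrier G \<and> U n \<subseteq> (\<Union>h\<in>F. h <# V)"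
    if V: "openin T V" "\<one> \<in> V" for V
  proof -
    \<comment> \<open>The translates of \<open>V\<close> are open in the copy \<open>A\<close> of
      the group; \<open>Q h\<close> extends them to open sets of \<open>K\<close>, where compactness
      is available.\<close>
    have "\<exists>Q. openin K Q \<and> f ` (h <# V) = Q \<inter> A" if "h \<in> carrier G" for h
      using f_open l_coset_open[OF V(1) that] unfolding open_map_def openin_subtopology by blast
    then obtain Q where Q: "\<And>h. h \<in> carrier G \<Longrightarrow> openin K (Q h)"
      "\<And>h. h \<in> carrier G \<Longrightarrow> f ` (h <# V) = Q h \<inter> A"
      by metis
    define Z where "Z = (\<Inter>n. K closure_of (W n))"
    have "compactin K Z"
      unfolding Z_def using K(1) by (intro closedin_compact_space closedin_Inter) auto
    have "Z \<subseteq> A"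
    proof
      fix z assume "z \<in> Z"
      then have "z \<in> C n" for n
        using W(3)[of n] unfolding Z_def by blast
      then show "z \<in> A"
        using C(2) by blast
    qed
    have "Z \<subseteq> \<Union>(Q ` carrier G)"
    proof
      fix z assume "z \<in> Z"
      then have z: "z \<in> A"
        using \<open>Z \<subseteq> A\<close> by blast
      then have h: "g z \<in> carrier G"
        using gT topspace_eq by blast
      then have "g z \<in> g z <# V"
        using V(2) r_one[OF h] unfolding l_coset_def by force
      then have "f (g z) \<in> Q (g z)"
        using Q(2)[OF h] by blast
      then show "z \<in> \<Union>(Q ` carrier G)"
        using h fg'[OF z] by auto
    qed
    moreover have "\<forall>S\<in>Q ` carrier G. openin K S"
      using Q(1) by blast
    ultimately obtain \<F> where \<F>: "finite \<F>" "\<F> \<subseteq> Q ` carrier G" "Z \<subseteq> \<Union>\<F>"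
      using \<open>compactin K Z\<close> unfolding compactin_def by meson
    obtain F where F: "F \<subseteq> carrier G" "finite F" "\<F> = Q ` F"
      using finite_subset_image[OF \<F>(1,2)] by blast
    have open_F: "openin K (\<Union>\<F>)"
      using \<F>(2) Q(1) by blast
    \<comment> \<open>The closures decrease to \<open>Z\<close>. Nonempty remainders outside the
      open union would have a common point by compactness, and that point would lie in
      \<open>Z\<close>.\<close>
    have "\<exists>n. K closure_of (W n) \<subseteq> \<Union>\<F>"
    proof (rule ccontr)
      assume contra: "\<nexists>n. K closure_of (W n) \<subseteq> \<Union>\<F>"
      have "(\<Inter>n. K closure_of (W n) - \<Union>\<F>) \<noteq> {}"
      proof (rule compact_space_imp_nest[OF K(1)])
        show "closedin K (K closure_of (W n) - \<Union>\<F>)" for n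
          using open_F by (simp add: closedin_diff)
        show "K closure_of (W n) - \<Union>\<F> \<noteq> {}" for n
          using contra by blast
        show "decseq (\<lambda>n. K closure_of (W n) - \<Union>\<F>)"
          using decseqD[OF W_dec] by (intro decseq_SucI Diff_mono closure_of_mono) auto
      qed
      then show False
        using \<F>(3) unfolding Z_def by blast
    qed
    then obtain n where n: "K closure_of (W n) \<subseteq> \<Union>\<F>"
      by blast
    have "U n \<subseteq> (\<Union>h\<in>F. h <# V)"
    proof
      fix x assume "x \<in> U n"
      then have x: "x \<in> topspace T" "f x \<in> W n"
        by (auto simp: U_def U'_def)
      then obtain h where h: "h \<in> F" "f x \<in> Q h"
        using n W_cl[of n] F(3) by blast
      then have "f x \<in> f ` (h <# V)"
        using Q(2)[of h] F(1) fA x(1) by blast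
      then obtain y where y: "y \<in> h <# V" "f x = f y"
        by blast
      then have "y \<in> topspace T"
        using l_coset_open[OF V(1)] h(1) F(1) openin_subset by blast
      then have "x = y"
        using gf x(1) y(2) by metis
      then show "x \<in> (\<Union>h\<in>F. h <# V)"
        using y(1) h(1) by blast
    qed
    then show ?thesis
      using F(1,2) by blast
  qed
  show ?thesis
    using U_sym U_dec total by blast
qed

end

section \<open>Subgroups of products\<close>

definition cylinder :: "('i \<Rightarrow> 'a) set \<Rightarrow> 'i set \<Rightarrow> ('i \<Rightarrow> 'a set) \<Rightarrow> ('i \<Rightarrow> 'a) set" where
  "cylinder H S B = {h \<in> H. \<forall>i\<in>S. h i \<in> B i}"

locale product_subgroup =
  fixes I :: "'i set" and G :: "'i \<Rightarrow> 'a monoid" and T :: "'i \<Rightarrow> 'a topology"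
    and H :: "('i \<Rightarrow> 'a) set"
  assumes factors: "\<And>i. i \<in> I \<Longrightarrow> topological_group (G i) (T i)"
    and sub: "subgroup H (product_group I G)"
begin

abbreviation HG :: "('i \<Rightarrow> 'a) monoid" where "HG \<equiv> (product_group I G)\<lparr>carrier := H\<rparr>"

abbreviation HT :: "('i \<Rightarrow> 'a) topology" where "HT \<equiv> subtopology (product_topology T I) H"

section \<open>Coordinatewise operations and open cylinders in the subgroup\<close>

lemma factor_group: "i \<in> I \<Longrightarrow> group (G i)"
  using factors by (simp add: topological_group_def)

lemma group_P: "group (product_group I G)"
  by (simp add: factor_group)

lemma group_HG: "group HG"
  using sub group_P by (rule subgroup.subgroup_is_group)

lemma H_subset: "H \<subseteq> (\<Pi>\<^sub>E i\<in>I. carrier (G i))"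
  using subgroup.subset[OF sub] by simp

lemma H_component: "h \<in> H \<Longrightarrow> i \<in> I \<Longrightarrow> h i \<in> carrier (G i)"
  using H_subset by blast

lemma topspace_HT: "topspace HT = H"
proof -
  have "(\<Pi>\<^sub>E i\<in>I. topspace (T i)) = (\<Pi>\<^sub>E i\<in>I. carrier (G i))"
    by (intro PiE_cong) (simp add: topspace_eq factors)
  then show ?thesis
    using H_subset by auto
qed

lemma HG_mult: "i \<in> I \<Longrightarrow> (g \<otimes>\<^bsub>HG\<^esub> h) i = g i \<otimes>\<^bsub>G i\<^esub> h i"
  by simp

lemma HG_one: "i \<in> I \<Longrightarrow> \<one>\<^bsub>HG\<^esub> i = \<one>\<^bsub>G i\<^esub>"
  by simp

lemma HG_inv: "h \<in> H \<Longrightarrow> i \<in> I \<Longrightarrow> (inv\<^bsub>HG\<^esub> h) i = inv\<^bsub>G i\<^esub> (h i)"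
  using H_subset group.m_inv_consistent[OF group_P sub, of h]
  by (auto simp: inv_product_group factor_group)

lemma HG_mult_closed: "g \<in> H \<Longrightarrow> h \<in> H \<Longrightarrow> g \<otimes>\<^bsub>HG\<^esub> h \<in> H"
  using group.is_monoid[OF group_HG] monoid.m_closed by fastforce

lemma HG_inv_closed: "h \<in> H \<Longrightarrow> inv\<^bsub>HG\<^esub> h \<in> H"
  using group.inv_closed[OF group_HG] by fastforce

lemma HG_one_closed: "\<one>\<^bsub>HG\<^esub> \<in> H"
  using group.is_monoid[OF group_HG] monoid.one_closed by fastforce

lemma HT_component_continuous: "i \<in> I \<Longrightarrow> continuous_map HT (T i) (\<lambda>h. h i)"
  by (intro continuous_map_from_subtopology continuous_map_product_projection)

lemma HT_continuous_mapI:
  assumes "\<And>h. h \<in> H \<Longrightarrow> f h \<in> H" "\<And>i. i \<in> I \<Longrightarrow> continuous_map HT (T i) (\<lambda>h. f h i)"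
  shows "continuous_map HT HT f"
  unfolding continuous_map_in_subtopology continuous_map_componentwise
  using assms H_subset topspace_HT by (auto simp: PiE_def)

lemma HG_left_translation:
  assumes a: "a \<in> H" shows "continuous_map HT HT (\<lambda>h. a \<otimes>\<^bsub>HG\<^esub> h)"
proof (rule HT_continuous_mapI)
  show "a \<otimes>\<^bsub>HG\<^esub> h \<in> H" if "h \<in> H" for h
    using HG_mult_closed a that .
  fix i assume i: "i \<in> I"
  have "continuous_map HT (T i) ((\<lambda>x. a i \<otimes>\<^bsub>G i\<^esub> x) \<circ> (\<lambda>h. h i))"
    using HT_component_continuous[OF i]
      left_translation_continuous[OF factors[OF i] H_component[OF a i]]
    by (rule continuous_map_compose)
  then show "continuous_map HT (T i) (\<lambda>h. (a \<otimes>\<^bsub>HG\<^esub> h) i)"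
    using i by (simp add: o_def)
qed

lemma HG_right_translation:
  assumes a: "a \<in> H" shows "continuous_map HT HT (\<lambda>h. h \<otimes>\<^bsub>HG\<^esub> a)"
proof (rule HT_continuous_mapI)
  show "h \<otimes>\<^bsub>HG\<^esub> a \<in> H" if "h \<in> H" for h
    using HG_mult_closed that a .
  fix i assume i: "i \<in> I"
  have "continuous_map HT (T i) ((\<lambda>x. x \<otimes>\<^bsub>G i\<^esub> a i) \<circ> (\<lambda>h. h i))"
    using HT_component_continuous[OF i]
      right_translation_continuous[OF factors[OF i] H_component[OF a i]]
    by (rule continuous_map_compose)
  then show "continuous_map HT (T i) (\<lambda>h. (h \<otimes>\<^bsub>HG\<^esub> a) i)"
    using i by (simp add: o_def)
qed

lemma cylinder_open:
  assumes "finite S" "S \<subseteq> I" "\<And>i. i \<in> I \<Longrightarrow> openin (T i) (B i)"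
  shows "openin HT (cylinder H S B)"
proof -
  let ?B = "\<lambda>i. if i \<in> S then B i else topspace (T i)"
  have "finite {i \<in> I. ?B i \<noteq> topspace (T i)}"
    by (rule finite_subset[OF _ assms(1)]) auto
  moreover have "\<forall>i\<in>I. openin (T i) (?B i)"
    using assms(3) by simp
  ultimately have "openin (product_topology T I) (PiE I ?B)"
    unfolding openin_PiE_gen by blast
  moreover have "cylinder H S B = PiE I ?B \<inter> H"
  proof (intro equalityI subsetI)
    fix h assume "h \<in> cylinder H S B"
    then have h: "h \<in> H" "\<And>i. i \<in> S \<Longrightarrow> h i \<in> B i"
      by (auto simp: cylinder_def)
    have "h i \<in> ?B i" if "i \<in> I" for i
      using h(2) H_component[OF h(1) that] topspace_eq[OF factors[OF that]] by simp
    moreover have "h \<in> extensional I"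
      using H_subset h(1) by (auto simp: PiE_def)
    ultimately show "h \<in> PiE I ?B \<inter> H"
      using h(1) by (simp add: PiE_iff)
  next
    fix h assume h: "h \<in> PiE I ?B \<inter> H"
    have "h i \<in> B i" if "i \<in> S" for i
      using PiE_mem[of h I ?B i] h that assms(2) by auto
    then show "h \<in> cylinder H S B"
      using h by (simp add: cylinder_def)
  qed
  ultimately show ?thesis
    by (auto simp: openin_subtopology)
qed

text \<open>A basic open set of the product restricts only finitely many coordinates. The finite
  sets found in this way are what the countable set \<open>J\<close> is later assembled
  from.\<close>

lemma cylinder_base:
  assumes "openin HT S" "\<one>\<^bsub>HG\<^esub> \<in> S"
  shows "\<exists>F B. finite F \<and> F \<subseteq> I \<and> (\<forall>i\<in>I. sym_nbhd (G i) (T i) (B i)) \<and> cylinder H F B \<subseteq> S"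
proof -
  obtain Q where Q: "openin (product_topology T I) Q" "S = Q \<inter> H"
    using assms(1) by (auto simp: openin_subtopology)
  have "\<one>\<^bsub>HG\<^esub> \<in> Q"
    using assms(2) Q(2) by blast
  from Q(1)[unfolded openin_product_topology_alt, THEN bspec, OF this]
  obtain U where U: "finite {i \<in> I. U i \<noteq> topspace (T i)}" "\<forall>i\<in>I. openin (T i) (U i)"
    "\<one>\<^bsub>HG\<^esub> \<in> PiE I U" "PiE I U \<subseteq> Q"
    by (elim exE conjE)
  have "\<forall>i\<in>I. \<exists>B. B \<subseteq> U i \<and> sym_nbhd (G i) (T i) B"
  proof
    fix i assume i: "i \<in> I"
    have "\<one>\<^bsub>G i\<^esub> \<in> U i"
      using PiE_mem[OF U(3) i] i by simp
    then show "\<exists>B. B \<subseteq> U i \<and> sym_nbhd (G i) (T i) B"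
      using sym_nbhd_shrink[OF factors[OF i]] U(2) i by blast
  qed
  from bchoice[OF this] obtain B where B: "\<forall>i\<in>I. B i \<subseteq> U i \<and> sym_nbhd (G i) (T i) (B i)" ..
  have "cylinder H {i \<in> I. U i \<noteq> topspace (T i)} B \<subseteq> S"
  proof
    fix h assume h: "h \<in> cylinder H {i \<in> I. U i \<noteq> topspace (T i)} B"
    then have hH: "h \<in> H"
      by (simp add: cylinder_def)
    have "h i \<in> U i" if i: "i \<in> I" for i
    proof (cases "U i = topspace (T i)")
      case True
      then show ?thesis
        using H_component[OF hH i] topspace_eq[OF factors[OF i]] by simp
    next
      case False
      then show ?thesis
        using h i B by (auto simp: cylinder_def)
    qed
    moreover have "h \<in> extensional I"
      using H_subset hH by (auto simp: PiE_def)
    ultimately have "h \<in> PiE I U"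
      by (simp add: PiE_iff)
    then show "h \<in> S"
      using U(4) Q(2) hH by blast
  qed
  then show ?thesis
    using U(1) B by blast
qed

text \<open>For \<open>J \<subseteq> I\<close> this is a neighbourhood base at the unit for the
  topology that \<open>H\<close> inherits from the product over \<open>J\<close>. Keeping
  \<open>H\<close> and coarsening its topology avoids passing to the projected group, which might
  not act on the space. Asking for \<open>B i\<close> at every \<open>i\<close> in \<open>I\<close>
  lets choices be made uniformly over all factors.\<close>

definition cylinders :: "'i set \<Rightarrow> ('i \<Rightarrow> 'a) set set" where
  "cylinders J = {cylinder H S B | S B. finite S \<and> S \<subseteq> J \<and> (\<forall>i\<in>I. sym_nbhd (G i) (T i) (B i))}"

lemma cylindersI:
  "finite S \<Longrightarrow> S \<subseteq> J \<Longrightarrow> (\<And>i. i \<in> I \<Longrightarrow> sym_nbhd (G i) (T i) (B i)) \<Longrightarrow> cylinder H S B \<in> cylinders J"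
  by (auto simp: cylinders_def)

lemma cylindersE:
  assumes "V \<in> cylinders J"
  obtains S B where "V = cylinder H S B" "finite S" "S \<subseteq> J"
    "\<And>i. i \<in> I \<Longrightarrow> sym_nbhd (G i) (T i) (B i)"
  using assms unfolding cylinders_def by blast

lemma cylinders_inv:
  assumes "J \<subseteq> I" "V \<in> cylinders J" "v \<in> V"
  shows "inv\<^bsub>HG\<^esub> v \<in> V"
proof -
  obtain S B where V: "V = cylinder H S B" "S \<subseteq> J" "\<And>i. i \<in> I \<Longrightarrow> sym_nbhd (G i) (T i) (B i)"
    using assms(2) by (rule cylindersE) (rule that)
  have v: "v \<in> H" "\<And>i. i \<in> S \<Longrightarrow> v i \<in> B i"
    using assms(3) V(1) by (auto simp: cylinder_def)
  have "(inv\<^bsub>HG\<^esub> v) i \<in> B i" if i: "i \<in> S" for i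
  proof -
    have iI: "i \<in> I"
      using i V(2) assms(1) by blast
    then show ?thesis
      using V(3)[OF iI] v(2)[OF i] by (simp only: HG_inv[OF v(1) iI] sym_nbhd_def)
  qed
  then show ?thesis
    using HG_inv_closed[OF v(1)] V(1) unfolding cylinder_def by blast
qed

lemma cylinders_Int:
  assumes "V \<in> cylinders J" "W \<in> cylinders J"
  shows "\<exists>Z\<in>cylinders J. Z \<subseteq> V \<inter> W"
proof -
  obtain S B where V: "V = cylinder H S B" "finite S" "S \<subseteq> J"
    "\<And>i. i \<in> I \<Longrightarrow> sym_nbhd (G i) (T i) (B i)"
    using assms(1) by (rule cylindersE) (rule that)
  obtain S' B' where W: "W = cylinder H S' B'" "finite S'" "S' \<subseteq> J"
    "\<And>i. i \<in> I \<Longrightarrow> sym_nbhd (G i) (T i) (B' i)"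
    using assms(2) by (rule cylindersE) (rule that)
  show ?thesis
  proof
    show "cylinder H (S \<union> S') (\<lambda>i. B i \<inter> B' i) \<in> cylinders J"
      using V W by (intro cylindersI) (auto simp: sym_nbhd_def)
    show "cylinder H (S \<union> S') (\<lambda>i. B i \<inter> B' i) \<subseteq> V \<inter> W"
      using V(1) W(1) by (auto simp: cylinder_def)
  qed
qed

lemma cylinders_square:
  assumes J: "J \<subseteq> I" and "V \<in> cylinders J"
  shows "\<exists>W\<in>cylinders J. \<forall>a\<in>W. \<forall>b\<in>W. a \<otimes>\<^bsub>HG\<^esub> b \<in> V"
proof -
  obtain S B where V: "V = cylinder H S B" "finite S" "S \<subseteq> J"
    "\<And>i. i \<in> I \<Longrightarrow> sym_nbhd (G i) (T i) (B i)"
    using assms(2) by (rule cylindersE) (rule that)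
  have "\<forall>i\<in>I. \<exists>B'. sym_nbhd (G i) (T i) B' \<and> (\<forall>x\<in>B'. \<forall>y\<in>B'. x \<otimes>\<^bsub>G i\<^esub> y \<in> B i)"
    using sym_nbhd_square[OF factors] V(4) unfolding sym_nbhd_def by simp
  from bchoice[OF this] obtain B' where
    B': "\<forall>i\<in>I. sym_nbhd (G i) (T i) (B' i) \<and> (\<forall>x\<in>B' i. \<forall>y\<in>B' i. x \<otimes>\<^bsub>G i\<^esub> y \<in> B i)" ..
  show ?thesis
  proof (intro bexI ballI)
    show "cylinder H S B' \<in> cylinders J"
      using V B' by (intro cylindersI) auto
    fix a b assume ab: "a \<in> cylinder H S B'" "b \<in> cylinder H S B'"
    then have "a \<otimes>\<^bsub>HG\<^esub> b \<in> H"
      by (intro HG_mult_closed) (auto simp: cylinder_def)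
    moreover have "(a \<otimes>\<^bsub>HG\<^esub> b) i \<in> B i" if i: "i \<in> S" for i
    proof -
      have iI: "i \<in> I"
        using i V(3) J by blast
      show ?thesis
        unfolding HG_mult[OF iI] using B' iI i ab by (simp add: cylinder_def)
    qed
    ultimately show "a \<otimes>\<^bsub>HG\<^esub> b \<in> V"
      using V(1) unfolding cylinder_def by blast
  qed
qed

text \<open>Conjugation works coordinatewise, so the same finite set of coordinates suffices. This
  lets a set \<open>J\<close> found at one point of a transitive action serve at all points.\<close>

lemma cylinders_conj:
  assumes J: "J \<subseteq> I" and "V \<in> cylinders J" and g: "g \<in> H"
  shows "\<exists>W\<in>cylinders J. \<forall>w\<in>W. inv\<^bsub>HG\<^esub> g \<otimes>\<^bsub>HG\<^esub> w \<otimes>\<^bsub>HG\<^esub> g \<in> V"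
proof -
  obtain S B where V: "V = cylinder H S B" "finite S" "S \<subseteq> J"
    "\<And>i. i \<in> I \<Longrightarrow> sym_nbhd (G i) (T i) (B i)"
    using assms(2) by (rule cylindersE) (rule that)
  have "\<forall>i\<in>I. \<exists>B'. sym_nbhd (G i) (T i) B' \<and> (\<forall>x\<in>B'. inv\<^bsub>G i\<^esub> (g i) \<otimes>\<^bsub>G i\<^esub> x \<otimes>\<^bsub>G i\<^esub> g i \<in> B i)"
    using sym_nbhd_conj[OF factors _ _ H_component[OF g]] V(4) unfolding sym_nbhd_def by simp
  from bchoice[OF this] obtain B' where B': "\<forall>i\<in>I. sym_nbhd (G i) (T i) (B' i) \<and>
      (\<forall>x\<in>B' i. inv\<^bsub>G i\<^esub> (g i) \<otimes>\<^bsub>G i\<^esub> x \<otimes>\<^bsub>G i\<^esub> g i \<in> B i)" ..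
  show ?thesis
  proof (intro bexI ballI)
    show "cylinder H S B' \<in> cylinders J"
      using V B' by (intro cylindersI) auto
    fix w assume w: "w \<in> cylinder H S B'"
    then have "inv\<^bsub>HG\<^esub> g \<otimes>\<^bsub>HG\<^esub> w \<otimes>\<^bsub>HG\<^esub> g \<in> H"
      using g by (intro HG_mult_closed HG_inv_closed) (auto simp: cylinder_def)
    moreover have "(inv\<^bsub>HG\<^esub> g \<otimes>\<^bsub>HG\<^esub> w \<otimes>\<^bsub>HG\<^esub> g) i \<in> B i" if i: "i \<in> S" for i
    proof -
      have iI: "i \<in> I"
        using i V(3) J by blast
      show ?thesis
        unfolding HG_mult[OF iI] HG_inv[OF g iI] using B' iI i w by (simp add: cylinder_def)
    qed
    ultimately show "inv\<^bsub>HG\<^esub> g \<otimes>\<^bsub>HG\<^esub> w \<otimes>\<^bsub>HG\<^esub> g \<in> V"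
      using V(1) unfolding cylinder_def by blast
  qed
qed

end

section \<open>Total boundedness and reduction to countably many coordinates\<close>

context product_subgroup
begin

text \<open>The factorwise covers are combined over finitely many coordinates. Their centres form
  elements of the product that may lie outside \<open>H\<close>; replacing them by representatives
  from \<open>H\<close> costs one halving of the neighbourhoods.\<close>

lemma cylinders_total:
  assumes cech: "\<And>i. i \<in> I \<Longrightarrow> cech_complete TYPE('k) (T i)" and J: "countable J" "J \<subseteq> I"
  shows "\<exists>U :: nat \<Rightarrow> ('i \<Rightarrow> 'a) set. (\<forall>n. U n \<in> cylinders J) \<and> decseq U \<and>
    (\<forall>V\<in>cylinders J. \<exists>n F. finite F \<and> F \<subseteq> H \<and> U n \<subseteq> (\<Union>f\<in>F. f <#\<^bsub>HG\<^esub> V))"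
proof -
  have "\<forall>i\<in>I. \<exists>U :: nat \<Rightarrow> 'a set. (\<forall>n. sym_nbhd (G i) (T i) (U n)) \<and> decseq U \<and>
    (\<forall>V. openin (T i) V \<longrightarrow> \<one>\<^bsub>G i\<^esub> \<in> V \<longrightarrow>
      (\<exists>n F. finite F \<and> F \<subseteq> carrier (G i) \<and> U n \<subseteq> (\<Union>f\<in>F. f <#\<^bsub>G i\<^esub> V)))"
    using cech_complete_totally_bounded_nbhds[OF factors cech] by blast
  from bchoice[OF this] obtain u :: "'i \<Rightarrow> nat \<Rightarrow> 'a set" where
    u: "\<forall>i\<in>I. (\<forall>n. sym_nbhd (G i) (T i) (u i n)) \<and> decseq (u i) \<and>
      (\<forall>V. openin (T i) V \<longrightarrow> \<one>\<^bsub>G i\<^esub> \<in> V \<longrightarrow>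
        (\<exists>n F. finite F \<and> F \<subseteq> carrier (G i) \<and> u i n \<subseteq> (\<Union>f\<in>F. f <#\<^bsub>G i\<^esub> V)))" ..
  define J' where "J' n = {j \<in> J. to_nat_on J j \<le> n}" for n
  have J'_finite: "finite (J' n)" for n
  proof (rule inj_on_finite)
    show "inj_on (to_nat_on J) (J' n)"
      using inj_on_to_nat_on[OF J(1)] by (rule inj_on_subset) (auto simp: J'_def)
    show "to_nat_on J ` J' n \<subseteq> {..n}"
      by (auto simp: J'_def)
  qed simp
  \<comment> \<open>A diagonal choice: raising \<open>n\<close> adds coordinates and shrinks the set
    in each coordinate.\<close>
  define U where "U n = cylinder H (J' n) (\<lambda>i. u i n)" for n
  have U_cyl: "U n \<in> cylinders J" for n
    unfolding U_def using J'_finite u by (intro cylindersI) (auto simp: J'_def)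
  have U_dec: "decseq U"
    unfolding decseq_def
  proof (intro allI impI subsetI)
    fix m n :: nat and h assume mn: "m \<le> n" and h: "h \<in> U n"
    have "h i \<in> u i m" if "i \<in> J' m" for i
    proof -
      have "i \<in> J' n" "i \<in> I"
        using that mn J(2) by (auto simp: J'_def)
      then have "h i \<in> u i n" "u i n \<subseteq> u i m"
        using h u decseqD[OF _ mn, of "u i"] by (auto simp: U_def cylinder_def)
      then show ?thesis
        by blast
    qed
    then show "h \<in> U m"
      using h by (simp add: U_def cylinder_def)
  qed
  have total: "\<exists>n F. finite F \<and> F \<subseteq> H \<and> U n \<subseteq> (\<Union>f\<in>F. f <#\<^bsub>HG\<^esub> V)" if V0: "V \<in> cylinders J" for V
  proof -
    obtain S B where V: "V = cylinder H S B" "finite S" "S \<subseteq> J"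
      "\<And>i. i \<in> I \<Longrightarrow> sym_nbhd (G i) (T i) (B i)"
      using V0 by (rule cylindersE) (rule that)
    have SI: "S \<subseteq> I"
      using V(3) J(2) by blast
    have "\<forall>i\<in>I. \<exists>B'. sym_nbhd (G i) (T i) B' \<and> (\<forall>x\<in>B'. \<forall>y\<in>B'. x \<otimes>\<^bsub>G i\<^esub> y \<in> B i)"
      using sym_nbhd_square[OF factors] V(4) unfolding sym_nbhd_def by simp
    from bchoice[OF this] obtain B' where
      B': "\<forall>i\<in>I. sym_nbhd (G i) (T i) (B' i) \<and> (\<forall>x\<in>B' i. \<forall>y\<in>B' i. x \<otimes>\<^bsub>G i\<^esub> y \<in> B i)" ..
    have "\<forall>i\<in>I. \<exists>n F. finite F \<and> F \<subseteq> carrier (G i) \<and> u i n \<subseteq> (\<Union>f\<in>F. f <#\<^bsub>G i\<^esub> B' i)"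
    proof
      fix i assume "i \<in> I"
      then have "openin (T i) (B' i)" "\<one>\<^bsub>G i\<^esub> \<in> B' i"
        using B' by (auto simp: sym_nbhd_def)
      then show "\<exists>n F. finite F \<and> F \<subseteq> carrier (G i) \<and> u i n \<subseteq> (\<Union>f\<in>F. f <#\<^bsub>G i\<^esub> B' i)"
        using u \<open>i \<in> I\<close> by simp
    qed
    from bchoice[OF this] obtain k where
      "\<forall>i\<in>I. \<exists>F. finite F \<and> F \<subseteq> carrier (G i) \<and> u i (k i) \<subseteq> (\<Union>f\<in>F. f <#\<^bsub>G i\<^esub> B' i)" ..
    from bchoice[OF this] obtain F where
      F: "\<forall>i\<in>I. finite (F i) \<and> F i \<subseteq> carrier (G i) \<and> u i (k i) \<subseteq> (\<Union>f\<in>F i. f <#\<^bsub>G i\<^esub> B' i)" ..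
    \<comment> \<open>The sum dominates every \<open>k i\<close>, so that \<open>u i N\<close> is
      covered by translates, and every \<open>to_nat_on J i\<close>, so that \<open>S\<close> is
      contained in \<open>J' N\<close>.\<close>
    define N where "N = (\<Sum>i\<in>S. k i + to_nat_on J i)"
    have N: "k i \<le> N" "to_nat_on J i \<le> N" if "i \<in> S" for i
      using member_le_sum[of i S "\<lambda>i. k i + to_nat_on J i"] V(2) that by (auto simp: N_def)
    \<comment> \<open>\<open>Z \<phi>\<close> is the trace on \<open>H\<close> of a box of
      translates with centres \<open>\<phi>\<close>. Only boxes meeting \<open>H\<close> are kept,
      and \<open>r\<close> picks a centre inside \<open>H\<close> from each.\<close>
    define Z where "Z \<phi> = {h \<in> H. \<forall>i\<in>S. h i \<in> \<phi> i <#\<^bsub>G i\<^esub> B' i}" for \<phi>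
    define \<Phi> where "\<Phi> = {\<phi> \<in> PiE S F. Z \<phi> \<noteq> {}}"
    define r where "r \<phi> = (SOME h. h \<in> Z \<phi>)" for \<phi>
    have r: "r \<phi> \<in> Z \<phi>" if "\<phi> \<in> \<Phi>" for \<phi>
      using that some_in_eq[of "Z \<phi>"] by (simp add: \<Phi>_def r_def)
    have "finite (PiE S F)"
      using V(2) F SI by (intro finite_PiE) auto
    then have "finite \<Phi>"
      unfolding \<Phi>_def by simp
    moreover have "r ` \<Phi> \<subseteq> H"
      using r by (auto simp: Z_def)
    moreover have "U N \<subseteq> (\<Union>f\<in>r ` \<Phi>. f <#\<^bsub>HG\<^esub> V)"
    proof
      fix h assume hU: "h \<in> U N"
      then have h: "h \<in> H"
        by (simp add: U_def cylinder_def)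
      have "\<forall>i\<in>S. \<exists>f. f \<in> F i \<and> h i \<in> f <#\<^bsub>G i\<^esub> B' i"
      proof
        fix i assume i: "i \<in> S"
        then have iI: "i \<in> I"
          using SI by blast
        have "h i \<in> u i N"
          using hU N(2)[OF i] i V(3) by (auto simp: U_def cylinder_def J'_def)
        also have "u i N \<subseteq> u i (k i)"
          using u iI decseqD[OF _ N(1)[OF i], of "u i"] by blast
        also have "\<dots> \<subseteq> (\<Union>f\<in>F i. f <#\<^bsub>G i\<^esub> B' i)"
          using F iI by blast
        finally show "\<exists>f. f \<in> F i \<and> h i \<in> f <#\<^bsub>G i\<^esub> B' i"
          by blast
      qed
      from bchoice[OF this] obtain \<psi> where \<psi>: "\<forall>i\<in>S. \<psi> i \<in> F i \<and> h i \<in> \<psi> i <#\<^bsub>G i\<^esub> B' i" ..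
      define \<phi> where "\<phi> = restrict \<psi> S"
      have "\<phi> \<in> PiE S F" and hZ: "h \<in> Z \<phi>"
        using \<psi> h by (auto simp: \<phi>_def Z_def)
      then have \<phi>: "\<phi> \<in> \<Phi>"
        by (auto simp: \<Phi>_def)
      let ?g = "r \<phi>"
      have g: "?g \<in> H" "\<forall>i\<in>S. ?g i \<in> \<phi> i <#\<^bsub>G i\<^esub> B' i"
        using r[OF \<phi>] by (auto simp: Z_def)
      let ?v = "inv\<^bsub>HG\<^esub> ?g \<otimes>\<^bsub>HG\<^esub> h"
      have "?v i \<in> B i" if i: "i \<in> S" for i
      proof -
        have iI: "i \<in> I"
          using i SI by blast
        interpret Gi: group "G i"
          using factor_group[OF iI] .
        \<comment> \<open>\<open>?g\<close> and \<open>h\<close> lie in the same box, so at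
          coordinate \<open>i\<close> they have a common centre, which cancels; the product that
          remains falls into \<open>B i\<close> by the choice of \<open>B'\<close>.\<close>
        obtain b where b: "b \<in> B' i" "?g i = \<phi> i \<otimes>\<^bsub>G i\<^esub> b"
          using g(2) i by (auto simp: l_coset_def)
        obtain c where c: "c \<in> B' i" "h i = \<phi> i \<otimes>\<^bsub>G i\<^esub> c"
          using hZ i by (auto simp: Z_def l_coset_def)
        have sym: "sym_nbhd (G i) (T i) (B' i)"
          using B' iI by blast
        then have "B' i \<subseteq> carrier (G i)"
          using openin_subset topspace_eq[OF factors[OF iI]] unfolding sym_nbhd_def by blast
        then have G: "b \<in> carrier (G i)" "c \<in> carrier (G i)" "\<phi> i \<in> carrier (G i)"
          using b c \<psi> i F iI by (auto simp: \<phi>_def)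
        have "inv\<^bsub>G i\<^esub> (?g i) \<otimes>\<^bsub>G i\<^esub> h i = inv\<^bsub>G i\<^esub> b \<otimes>\<^bsub>G i\<^esub> c"
          using G b(2) c(2)
          by (simp add: Gi.inv_mult_group Gi.m_assoc) (simp add: Gi.m_assoc[symmetric])
        also have "\<dots> \<in> B i"
          using B' iI b(1) c(1) sym by (simp add: sym_nbhd_def)
        finally show ?thesis
          unfolding HG_mult[OF iI] HG_inv[OF g(1) iI] .
      qed
      moreover have "?v \<in> H"
        using HG_mult_closed[OF HG_inv_closed[OF g(1)] h] .
      ultimately have "?v \<in> V"
        unfolding V(1) cylinder_def by blast
      moreover have "h = ?g \<otimes>\<^bsub>HG\<^esub> ?v"
      proof -
        interpret HG: group HG
          by (rule group_HG)
        have "?g \<in> carrier HG" "h \<in> carrier HG"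
          using g(1) h by simp_all
        then show ?thesis
          by (metis HG.inv_closed HG.l_one HG.m_assoc HG.r_inv)
      qed
      ultimately have "h \<in> ?g <#\<^bsub>HG\<^esub> V"
        unfolding l_coset_def by blast
      then show "h \<in> (\<Union>f\<in>r ` \<Phi>. f <#\<^bsub>HG\<^esub> V)"
        using \<phi> by blast
    qed
    ultimately show ?thesis
      by blast
  qed
  show ?thesis
    using U_cyl U_dec total by blast
qed

text \<open>Separate continuity is the common ground of the two alternatives: cosets supply
  continuous translations and orbit maps, and a jointly continuous action restricts to them.\<close>

theorem separately_continuous_action_metrizable:
  fixes X :: "'x topology"
  assumes cech: "\<And>i. i \<in> I \<Longrightarrow> cech_complete TYPE('k) (T i)"
    and X: "compact_space X" "Hausdorff_space X" "first_countable X"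
    and act_cont: "\<And>g. g \<in> H \<Longrightarrow> continuous_map X X (act g)"
    and orbit_cont: "\<And>x. x \<in> topspace X \<Longrightarrow> continuous_map HT X (\<lambda>g. act g x)"
    and act_one: "\<And>x. x \<in> topspace X \<Longrightarrow> act \<one>\<^bsub>HG\<^esub> x = x"
    and act_mult: "\<And>g h x. g \<in> H \<Longrightarrow> h \<in> H \<Longrightarrow> x \<in> topspace X \<Longrightarrow>
        act g (act h x) = act (g \<otimes>\<^bsub>HG\<^esub> h) x"
    and trans: "\<And>x y. x \<in> topspace X \<Longrightarrow> y \<in> topspace X \<Longrightarrow> \<exists>g\<in>H. act g x = y"
    and dopen: "\<And>x V. x \<in> topspace X \<Longrightarrow> openin HT V \<Longrightarrow> \<one>\<^bsub>HG\<^esub> \<in> V \<Longrightarrow>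
        x \<in> X interior_of (X closure_of ((\<lambda>g. act g x) ` V))"
  shows "metrizable_space X"
\<comment> \<open>The coordinates are read off from the orbit map of one point, so the empty space
  is treated apart.\<close>
proof (cases "topspace X = {}")
  case True
  then have "X = trivial_topology"
    by (simp only: null_topspace_iff_trivial)
  then show ?thesis
    by (simp add: empty_metrizable_space)
next
  case False
  then obtain x0 where x0: "x0 \<in> topspace X"
    by blast
  have carr: "carrier HG = H"
    by simp
  interpret HG: group HG
    by (rule group_HG)
  obtain B where B: "\<And>n. openin X (B n)" "\<And>n. x0 \<in> B n"
    "\<And>S. openin X S \<Longrightarrow> x0 \<in> S \<Longrightarrow> \<exists>n::nat. B n \<subseteq> S"
    using first_countable_decreasing_base[OF X(3) x0] by metis
  have "\<forall>n. \<exists>F C. finite F \<and> F \<subseteq> I \<and> (\<forall>i\<in>I. sym_nbhd (G i) (T i) (C i)) \<and>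
      cylinder H F C \<subseteq> {g \<in> topspace HT. act g x0 \<in> B n}"
  proof (rule allI, rule cylinder_base)
    fix n
    show "openin HT {g \<in> topspace HT. act g x0 \<in> B n}"
      using orbit_cont[OF x0] B(1) by (rule openin_continuous_map_preimage)
    show "\<one>\<^bsub>HG\<^esub> \<in> {g \<in> topspace HT. act g x0 \<in> B n}"
      unfolding topspace_HT using HG_one_closed act_one[OF x0] B(2) by (metis (lifting) mem_Collect_eq)
  qed
  from choice[OF this] obtain S where
    "\<forall>n. \<exists>C. finite (S n) \<and> S n \<subseteq> I \<and> (\<forall>i\<in>I. sym_nbhd (G i) (T i) (C i)) \<and>
      cylinder H (S n) C \<subseteq> {g \<in> topspace HT. act g x0 \<in> B n}" ..
  from choice[OF this] obtain C where
    SC: "\<forall>n. finite (S n) \<and> S n \<subseteq> I \<and> (\<forall>i\<in>I. sym_nbhd (G i) (T i) (C n i)) \<and>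
      cylinder H (S n) (C n) \<subseteq> {g \<in> topspace HT. act g x0 \<in> B n}" ..
  have S: "finite (S n)" "S n \<subseteq> I" "\<forall>i\<in>I. sym_nbhd (G i) (T i) (C n i)"
    "cylinder H (S n) (C n) \<subseteq> {g \<in> topspace HT. act g x0 \<in> B n}" for n
    using SC by blast+
  \<comment> \<open>These coordinates control the orbit map at \<open>x0\<close>, because the sets
    \<open>B n\<close> form a base there.\<close>
  define J where "J = (\<Union>n. S n)"
  have J: "countable J" "J \<subseteq> I"
    using S(1,2) by (auto simp: J_def intro: countable_finite)
  have base: "cylinder H (S n) (C n) \<in> cylinders J" for n
    using S(1,3) by (intro cylindersI) (auto simp: J_def)
  obtain U :: "nat \<Rightarrow> ('i \<Rightarrow> 'a) set" where U: "\<forall>n. U n \<in> cylinders J" "decseq U"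
    "\<forall>V\<in>cylinders J. \<exists>n F. finite F \<and> F \<subseteq> H \<and> U n \<subseteq> (\<Union>f\<in>F. f <#\<^bsub>HG\<^esub> V)"
    using cylinders_total[OF cech J] by blast
  have "nbhd_action HG X act (cylinders J) U"
  proof (rule nbhd_action.intro[OF group_HG], rule nbhd_action_axioms.intro)
    show "compact_space X" "Hausdorff_space X" "first_countable X"
      by (fact X)+
    show "continuous_map X X (act g)" if "g \<in> carrier HG" for g
      using act_cont that unfolding carr .
    show "act \<one>\<^bsub>HG\<^esub> x = x" if "x \<in> topspace X" for x
      using act_one[OF that] .
    show "act g (act h x) = act (g \<otimes>\<^bsub>HG\<^esub> h) x"
      if "g \<in> carrier HG" "h \<in> carrier HG" "x \<in> topspace X" for g h x
      using act_mult that unfolding carr .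
    show "V \<subseteq> carrier HG" if "V \<in> cylinders J" for V
      using that unfolding carr cylinders_def cylinder_def by blast
    show one: "\<one>\<^bsub>HG\<^esub> \<in> V" if V0: "V \<in> cylinders J" for V
    proof -
      obtain F D where V: "V = cylinder H F D" "finite F" "F \<subseteq> J"
        "\<And>i. i \<in> I \<Longrightarrow> sym_nbhd (G i) (T i) (D i)"
        using V0 by (rule cylindersE) (rule that)
      have "\<one>\<^bsub>HG\<^esub> i \<in> D i" if "i \<in> F" for i
      proof -
        have iI: "i \<in> I"
          using that V(3) J(2) by blast
        show ?thesis
          unfolding HG_one[OF iI] using V(4)[OF iI] by (simp add: sym_nbhd_def)
      qed
      then show ?thesis
        unfolding V(1) cylinder_def using HG_one_closed by blast
    qed
    show "inv\<^bsub>HG\<^esub> v \<in> V" if "V \<in> cylinders J" "v \<in> V" for V v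
      using cylinders_inv[OF J(2) that] .
    show "\<exists>Z\<in>cylinders J. Z \<subseteq> V \<inter> W" if "V \<in> cylinders J" "W \<in> cylinders J" for V W
      using cylinders_Int[OF that] .
    show "\<exists>W\<in>cylinders J. \<forall>a\<in>W. \<forall>b\<in>W. a \<otimes>\<^bsub>HG\<^esub> b \<in> V" if "V \<in> cylinders J" for V
      using cylinders_square[OF J(2) that] .
    show "\<exists>V\<in>cylinders J. \<forall>v\<in>V. act v x \<in> O1" if O1: "openin X O1" "x \<in> O1" for O1 x
    proof -
      have x: "x \<in> topspace X"
        using O1 openin_subset by blast
      \<comment> \<open>With \<open>x = g x0\<close>, the point \<open>w x\<close> is
        \<open>g\<close> applied to the image of \<open>x0\<close> under
        \<open>inv g \<otimes> w \<otimes> g\<close>; for small \<open>w\<close> this conjugate lies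
        in a cylinder over \<open>J\<close> that keeps \<open>x0\<close> in
        \<open>B n\<close>.\<close>
      obtain g where g: "g \<in> H" "act g x0 = x"
        using trans[OF x0 x] by blast
      have "openin X {y \<in> topspace X. act g y \<in> O1}"
        using act_cont[OF g(1)] O1(1) by (rule openin_continuous_map_preimage)
      then obtain n where n: "B n \<subseteq> {y \<in> topspace X. act g y \<in> O1}"
        using B(3) x0 g(2) O1(2) by blast
      obtain W where W: "W \<in> cylinders J"
        "\<forall>w\<in>W. inv\<^bsub>HG\<^esub> g \<otimes>\<^bsub>HG\<^esub> w \<otimes>\<^bsub>HG\<^esub> g \<in> cylinder H (S n) (C n)"
        using cylinders_conj[OF J(2) base g(1)] by blast
      have "act w x \<in> O1" if w: "w \<in> W" for w
      proof -
        have wH: "w \<in> H"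
          using w W(1) unfolding cylinders_def cylinder_def by blast
        let ?c = "inv\<^bsub>HG\<^esub> g \<otimes>\<^bsub>HG\<^esub> w \<otimes>\<^bsub>HG\<^esub> g"
        have cH: "?c \<in> H"
          by (intro HG_mult_closed HG_inv_closed g(1) wH)
        have "act ?c x0 \<in> B n"
          using S(4) W(2) w by blast
        then have "act g (act ?c x0) \<in> O1"
          using n by blast
        moreover have "g \<otimes>\<^bsub>HG\<^esub> ?c = w \<otimes>\<^bsub>HG\<^esub> g"
        proof -
          have G: "g \<in> carrier HG" "w \<in> carrier HG"
            using g(1) wH unfolding carr by blast+
          have "g \<otimes>\<^bsub>HG\<^esub> ?c = g \<otimes>\<^bsub>HG\<^esub> (inv\<^bsub>HG\<^esub> g \<otimes>\<^bsub>HG\<^esub> (w \<otimes>\<^bsub>HG\<^esub> g))"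
            using HG.m_assoc[OF HG.inv_closed[OF G(1)] G(2) G(1)] by (rule arg_cong)
          also have "\<dots> = g \<otimes>\<^bsub>HG\<^esub> inv\<^bsub>HG\<^esub> g \<otimes>\<^bsub>HG\<^esub> (w \<otimes>\<^bsub>HG\<^esub> g)"
            by (rule HG.m_assoc[symmetric]) (intro G HG.inv_closed HG.m_closed)+
          also have "\<dots> = w \<otimes>\<^bsub>HG\<^esub> g"
            unfolding HG.r_inv[OF G(1)] by (intro HG.l_one HG.m_closed G)
          finally show ?thesis .
        qed
        ultimately have "act (w \<otimes>\<^bsub>HG\<^esub> g) x0 \<in> O1"
          using act_mult[OF g(1) cH x0] by metis
        then show ?thesis
          using act_mult[OF wH g(1) x0] g(2) by metis
      qed
      then show ?thesis
        using W(1) by blast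
    qed
    show "x \<in> X interior_of (X closure_of ((\<lambda>g. act g x) ` V))"
      if x: "x \<in> topspace X" and V: "V \<in> cylinders J" for x V
    proof (rule dopen[OF x _ one[OF V]])
      obtain F D where F: "V = cylinder H F D" "finite F" "F \<subseteq> J"
        "\<And>i. i \<in> I \<Longrightarrow> sym_nbhd (G i) (T i) (D i)"
        using V by (rule cylindersE) (rule that)
      show "openin HT V"
        unfolding F(1)
      proof (rule cylinder_open[OF F(2)])
        show "F \<subseteq> I"
          using F(3) J(2) by blast
        show "openin (T i) (D i)" if "i \<in> I" for i
          using F(4)[OF that] by (simp add: sym_nbhd_def)
      qed
    qed
    show "U n \<in> cylinders J" for n
      using U(1) by blast
    show "decseq U"
      by (fact U(2))
    show "\<exists>n F. finite F \<and> F \<subseteq> carrier HG \<and> U n \<subseteq> (\<Union>f\<in>F. f <#\<^bsub>HG\<^esub> V)"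
      if "V \<in> cylinders J" for V
      unfolding carr using U(3) that by blast
  qed
  then show ?thesis
    by (rule nbhd_action.metrizable)
qed

end

section \<open>Coset spaces\<close>

text \<open>The arguments on cosets run through continuous translations, which for a subgroup of a
  product are checked coordinate by coordinate.\<close>

locale translation_group = group G for G (structure) +
  fixes T :: "'a topology" and K :: "'a set"
  assumes topspace_T: "topspace T = carrier G"
    and left: "a \<in> carrier G \<Longrightarrow> continuous_map T T (\<lambda>x. a \<otimes> x)"
    and right: "a \<in> carrier G \<Longrightarrow> continuous_map T T (\<lambda>x. x \<otimes> a)"
    and K: "subgroup K G"
begin

section \<open>Cosets and the quotient topology\<close>

lemma K_subset: "K \<subseteq> carrier G"
  using K by (rule subgroup.subset)

lemma coset_self: "x \<in> carrier G \<Longrightarrow> x \<in> x <# K"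
  using subgroup.one_closed[OF K] by (force simp: l_coset_def)

lemma coset_in: "x \<in> carrier G \<Longrightarrow> x <# K \<in> cosets_of G K"
  by (auto simp: cosets_of_def)

lemma coset_carrier: "C \<in> cosets_of G K \<Longrightarrow> x \<in> C \<Longrightarrow> x \<in> carrier G"
  using K_subset by (auto simp: cosets_of_def l_coset_def)

lemma coset_eq:
  assumes "C \<in> cosets_of G K" "x \<in> C" shows "C = x <# K"
proof -
  obtain a where a: "a \<in> carrier G" "C = a <# K"
    using assms(1) by (auto simp: cosets_of_def)
  then show ?thesis
    using l_repr_independence[OF _ a(1) K] assms(2) by blast
qed

text \<open>Distinct cosets are disjoint, so a family of cosets is recovered from its union; this
  translates between the quotient and the group.\<close>

lemma coset_mem_iff:
  assumes "\<U> \<subseteq> cosets_of G K" "x \<in> carrier G"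
  shows "x <# K \<in> \<U> \<longleftrightarrow> x \<in> \<Union>\<U>"
proof
  assume "x <# K \<in> \<U>"
  then show "x \<in> \<Union>\<U>"
    using coset_self[OF assms(2)] by blast
next
  assume "x \<in> \<Union>\<U>"
  then obtain C where "C \<in> \<U>" "x \<in> C"
    by blast
  then show "x <# K \<in> \<U>"
    using coset_eq[of C x] assms(1) by blast
qed

lemma Union_cosets: "\<Union>{C \<in> cosets_of G K. P C} = {x \<in> carrier G. P (x <# K)}"
proof (intro equalityI subsetI)
  fix x assume "x \<in> \<Union>{C \<in> cosets_of G K. P C}"
  then obtain C where C: "C \<in> cosets_of G K" "P C" "x \<in> C"
    by blast
  then show "x \<in> {x \<in> carrier G. P (x <# K)}"
    using coset_eq[OF C(1,3)] coset_carrier[OF C(1,3)] by simp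
next
  fix x assume "x \<in> {x \<in> carrier G. P (x <# K)}"
  then show "x \<in> \<Union>{C \<in> cosets_of G K. P C}"
    using coset_self coset_in by blast
qed

text \<open>The condition in \<open>coset_space\<close> has to be shown to be a topology.
  Intersections are the delicate case: disjointness of cosets makes union commute with
  intersection.\<close>

lemma openin_coset_space:
  "openin (coset_space G T K) \<U> \<longleftrightarrow> \<U> \<subseteq> cosets_of G K \<and> openin T (\<Union>\<U>)"
proof -
  have "istopology (\<lambda>\<U>. \<U> \<subseteq> cosets_of G K \<and> openin T (\<Union>\<U>))"
    unfolding istopology_def
  proof (intro conjI allI impI)
    fix \<U> \<V> assume U: "\<U> \<subseteq> cosets_of G K \<and> openin T (\<Union>\<U>)"
      and V: "\<V> \<subseteq> cosets_of G K \<and> openin T (\<Union>\<V>)"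
    show "\<U> \<inter> \<V> \<subseteq> cosets_of G K"
      using U by blast
    have "\<Union>(\<U> \<inter> \<V>) = \<Union>\<U> \<inter> \<Union>\<V>"
    proof (intro equalityI subsetI)
      fix x assume x: "x \<in> \<Union>\<U> \<inter> \<Union>\<V>"
      then have "x \<in> carrier G"
        using U coset_carrier by blast
      then show "x \<in> \<Union>(\<U> \<inter> \<V>)"
        using x U V coset_mem_iff[of \<U> x] coset_mem_iff[of \<V> x] coset_self[of x] by blast
    qed auto
    then show "openin T (\<Union>(\<U> \<inter> \<V>))"
      using U V by (simp add: openin_Int)
  next
    fix \<K> assume K: "\<forall>\<U>\<in>\<K>. \<U> \<subseteq> cosets_of G K \<and> openin T (\<Union>\<U>)"
    then show "\<Union>\<K> \<subseteq> cosets_of G K"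
      by blast
    have "openin T (\<Union>(Union ` \<K>))"
      using K by (intro openin_Union) auto
    moreover have "\<Union>(\<Union>\<K>) = \<Union>(Union ` \<K>)"
      by blast
    ultimately show "openin T (\<Union>(\<Union>\<K>))"
      by simp
  qed
  then show ?thesis
    unfolding coset_space_def by (simp add: topology_inverse')
qed

lemma topspace_coset_space: "topspace (coset_space G T K) = cosets_of G K"
proof (rule equalityI)
  show "topspace (coset_space G T K) \<subseteq> cosets_of G K"
    using openin_topspace[of "coset_space G T K"] unfolding openin_coset_space by blast
  have "\<Union>(cosets_of G K) = topspace T"
    using Union_cosets[of "\<lambda>_. True"] by (simp add: topspace_T)
  then have "openin (coset_space G T K) (cosets_of G K)"
    unfolding openin_coset_space by simp
  then show "cosets_of G K \<subseteq> topspace (coset_space G T K)"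
    by (rule openin_subset)
qed

lemma coset_act: "g \<in> carrier G \<Longrightarrow> x \<in> carrier G \<Longrightarrow> g <# (x <# K) = (g \<otimes> x) <# K"
  by (rule lcos_m_assoc[OF K_subset])

lemma coset_act_continuous:
  assumes g: "g \<in> carrier G"
  shows "continuous_map (coset_space G T K) (coset_space G T K) (\<lambda>C. g <# C)"
  unfolding continuous_map_alt topspace_coset_space
proof (intro conjI allI impI)
  show "(\<lambda>C. g <# C) \<in> cosets_of G K \<rightarrow> cosets_of G K"
    using g coset_act coset_in m_closed by (auto simp: cosets_of_def)
  fix \<U> assume U: "openin (coset_space G T K) \<U>"
  let ?P = "(\<lambda>C. g <# C) -` \<U> \<inter> cosets_of G K"
  have "\<Union>?P = \<Union>{C \<in> cosets_of G K. g <# C \<in> \<U>}"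
    by blast
  also have "\<dots> = {x \<in> topspace T. g \<otimes> x \<in> \<Union>\<U>}"
    unfolding Union_cosets topspace_T
    using coset_mem_iff[of \<U>] U g by (auto simp: openin_coset_space coset_act)
  also have "openin T \<dots>"
    using left[OF g] U by (intro openin_continuous_map_preimage) (auto simp: openin_coset_space)
  finally show "openin (coset_space G T K) ?P"
    unfolding openin_coset_space by blast
qed

lemma coset_orbit_continuous:
  assumes x: "x \<in> carrier G"
  shows "continuous_map T (coset_space G T K) (\<lambda>g. g <# (x <# K))"
  unfolding continuous_map_alt topspace_coset_space topspace_T
proof (intro conjI allI impI)
  show "(\<lambda>g. g <# (x <# K)) \<in> carrier G \<rightarrow> cosets_of G K"
    using x coset_act coset_in m_closed by auto
  fix \<U> assume U: "openin (coset_space G T K) \<U>"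
  have "(\<lambda>g. g <# (x <# K)) -` \<U> \<inter> carrier G = {g \<in> topspace T. g \<otimes> x \<in> \<Union>\<U>}"
    unfolding topspace_T
    using coset_mem_iff[of \<U>] U x by (auto simp: openin_coset_space coset_act)
  also have "openin T \<dots>"
    using right[OF x] U by (intro openin_continuous_map_preimage) (auto simp: openin_coset_space)
  finally show "openin T ((\<lambda>g. g <# (x <# K)) -` \<U> \<inter> carrier G)" .
qed

text \<open>The union of the image is \<open>V x K\<close>, a union of right translates of
  \<open>V\<close> by the elements \<open>x \<otimes> k\<close>, and each of these is open.\<close>

lemma coset_orbit_open:
  assumes V: "openin T V" and x: "x \<in> carrier G"
  shows "openin (coset_space G T K) ((\<lambda>g. g <# (x <# K)) ` V)"
  unfolding openin_coset_space
proof
  have VG: "V \<subseteq> carrier G"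
    using openin_subset[OF V] topspace_T by simp
  show "(\<lambda>g. g <# (x <# K)) ` V \<subseteq> cosets_of G K"
    using VG x coset_act coset_in m_closed by auto
  have "\<Union>((\<lambda>g. g <# (x <# K)) ` V) = (\<Union>k\<in>K. {y \<in> topspace T. y \<otimes> inv (x \<otimes> k) \<in> V})"
  proof (intro equalityI subsetI)
    fix y assume "y \<in> \<Union>((\<lambda>g. g <# (x <# K)) ` V)"
    then obtain g where g: "g \<in> V" "y \<in> g <# (x <# K)"
      by blast
    then obtain k where k: "k \<in> K" "y = g \<otimes> (x \<otimes> k)"
      by (auto simp: l_coset_def)
    have G: "g \<in> carrier G" "x \<otimes> k \<in> carrier G"
      using g(1) VG k(1) K_subset x by auto
    then have "y \<otimes> inv (x \<otimes> k) \<in> V" "y \<in> topspace T"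
      using k(2) g(1) by (simp_all add: m_assoc topspace_T)
    then show "y \<in> (\<Union>k\<in>K. {y \<in> topspace T. y \<otimes> inv (x \<otimes> k) \<in> V})"
      using k(1) by blast
  next
    fix y assume "y \<in> (\<Union>k\<in>K. {y \<in> topspace T. y \<otimes> inv (x \<otimes> k) \<in> V})"
    then obtain k where k: "k \<in> K" "y \<in> carrier G" "y \<otimes> inv (x \<otimes> k) \<in> V"
      using topspace_T by auto
    have "x \<otimes> k \<in> carrier G"
      using k(1) K_subset x by auto
    then have "y = y \<otimes> inv (x \<otimes> k) \<otimes> (x \<otimes> k)"
      using k(2) by (simp add: m_assoc)
    then have "y \<in> (y \<otimes> inv (x \<otimes> k)) <# (x <# K)"
      using k(1) unfolding l_coset_def by blast
    then show "y \<in> \<Union>((\<lambda>g. g <# (x <# K)) ` V)"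
      using k(3) by blast
  qed
  also have "openin T \<dots>"
  proof (intro openin_Union, clarify)
    fix k assume "k \<in> K"
    then have "inv (x \<otimes> k) \<in> carrier G"
      using x K_subset by auto
    then show "openin T {y \<in> topspace T. y \<otimes> inv (x \<otimes> k) \<in> V}"
      using right V by (intro openin_continuous_map_preimage)
  qed
  finally show "openin T (\<Union>((\<lambda>g. g <# (x <# K)) ` V))" .
qed

end

text \<open>The action is left translation of cosets. Its orbit maps are open, so the image of a
  neighbourhood of the unit is already an open neighbourhood of the point, and
  \<open>d\<close>-openness follows.\<close>

theorem (in product_subgroup) coset_space_metrizable:
  assumes cech: "\<And>i. i \<in> I \<Longrightarrow> cech_complete TYPE('k) (T i)"
    and K: "subgroup K HG"
    and X: "compact_space (coset_space HG HT K)" "Hausdorff_space (coset_space HG HT K)"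
      "first_countable (coset_space HG HT K)"
  shows "metrizable_space (coset_space HG HT K)"
proof -
  have carr: "carrier HG = H"
    by simp
  interpret C: translation_group HG HT K
  proof (rule translation_group.intro[OF group_HG], rule translation_group_axioms.intro)
    show "topspace HT = carrier HG"
      unfolding carr by (rule topspace_HT)
    show "continuous_map HT HT (\<lambda>x. a \<otimes>\<^bsub>HG\<^esub> x)" if "a \<in> carrier HG" for a
      using HG_left_translation that unfolding carr .
    show "continuous_map HT HT (\<lambda>x. x \<otimes>\<^bsub>HG\<^esub> a)" if "a \<in> carrier HG" for a
      using HG_right_translation that unfolding carr .
  qed (rule K)
  have coset: "\<exists>a\<in>H. C = a <#\<^bsub>HG\<^esub> K" if "C \<in> topspace (coset_space HG HT K)" for C
    using that unfolding C.topspace_coset_space cosets_of_def carr by blast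
  have act: "g <#\<^bsub>HG\<^esub> (a <#\<^bsub>HG\<^esub> K) = (g \<otimes>\<^bsub>HG\<^esub> a) <#\<^bsub>HG\<^esub> K" if "g \<in> H" "a \<in> H" for g a
    using C.coset_act[of g a] that unfolding carr .
  show ?thesis
  proof (rule separately_continuous_action_metrizable[OF cech X, where act = "\<lambda>g C. g <#\<^bsub>HG\<^esub> C"])
    show "continuous_map (coset_space HG HT K) (coset_space HG HT K) ((<#\<^bsub>HG\<^esub>) g)" if "g \<in> H" for g
      using C.coset_act_continuous[of g] that unfolding carr .
  next
    fix C assume "C \<in> topspace (coset_space HG HT K)"
    then obtain a where a: "a \<in> H" "C = a <#\<^bsub>HG\<^esub> K"
      using coset by blast
    show "continuous_map HT (coset_space HG HT K) (\<lambda>g. g <#\<^bsub>HG\<^esub> C)"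
      unfolding a(2) using C.coset_orbit_continuous[of a] a(1) unfolding carr .
    have "\<one>\<^bsub>HG\<^esub> \<otimes>\<^bsub>HG\<^esub> a = a"
      using C.l_one[of a] a(1) unfolding carr .
    then show one: "\<one>\<^bsub>HG\<^esub> <#\<^bsub>HG\<^esub> C = C"
      unfolding a(2) act[OF HG_one_closed a(1)] by (rule arg_cong)
    show "g <#\<^bsub>HG\<^esub> (h <#\<^bsub>HG\<^esub> C) = g \<otimes>\<^bsub>HG\<^esub> h <#\<^bsub>HG\<^esub> C" if gh: "g \<in> H" "h \<in> H" for g h
    proof -
      have "g \<otimes>\<^bsub>HG\<^esub> (h \<otimes>\<^bsub>HG\<^esub> a) = g \<otimes>\<^bsub>HG\<^esub> h \<otimes>\<^bsub>HG\<^esub> a"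
        using C.m_assoc[of g h a] gh a(1) unfolding carr by metis
      then show ?thesis
        unfolding a(2) act[OF gh(2) a(1)] act[OF gh(1) HG_mult_closed[OF gh(2) a(1)]]
          act[OF HG_mult_closed[OF gh] a(1)] by (rule arg_cong)
    qed
    show "\<exists>g\<in>H. g <#\<^bsub>HG\<^esub> C = D" if "D \<in> topspace (coset_space HG HT K)" for D
    proof -
      obtain b where b: "b \<in> H" "D = b <#\<^bsub>HG\<^esub> K"
        using coset \<open>D \<in> _\<close> by blast
      let ?g = "b \<otimes>\<^bsub>HG\<^esub> inv\<^bsub>HG\<^esub> a"
      have g: "?g \<in> H"
        by (intro HG_mult_closed HG_inv_closed a b)
      have G: "a \<in> carrier HG" "b \<in> carrier HG"
        using a(1) b(1) unfolding carr by blast+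
      have "?g \<otimes>\<^bsub>HG\<^esub> a = b"
        using G by (metis C.inv_closed C.l_inv C.m_assoc C.r_one)
      then have "?g <#\<^bsub>HG\<^esub> C = D"
        unfolding a(2) b(2) act[OF g a(1)] by (rule arg_cong)
      then show ?thesis
        using g by blast
    qed
    show "C \<in> (coset_space HG HT K) interior_of
        ((coset_space HG HT K) closure_of ((\<lambda>g. g <#\<^bsub>HG\<^esub> C) ` V))"
      if V: "openin HT V" "\<one>\<^bsub>HG\<^esub> \<in> V" for V
    proof (rule interior_of_maximal[THEN subsetD])
      let ?O = "(\<lambda>g. g <#\<^bsub>HG\<^esub> C) ` V"
      show open_O: "openin (coset_space HG HT K) ?O"
        unfolding a(2) using C.coset_orbit_open[OF V(1), of a] a(1) unfolding carr .
      show "?O \<subseteq> coset_space HG HT K closure_of ?O"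
        by (rule closure_of_subset[OF openin_subset[OF open_O]])
      show "C \<in> ?O"
        using V(2) one by (metis imageI)
    qed
  qed
qed

theorem theorem4p8:
  fixes X :: "'x topology"
    and I :: "'i set"
    and G :: "'i \<Rightarrow> 'a monoid"
    and T :: "'i \<Rightarrow> 'a topology"
    and H :: "('i \<Rightarrow> 'a) set"
  assumes compact: "compact_space X" "Hausdorff_space X"
    and character: "first_countable X"
    and factors: "\<And>i. i \<in> I \<Longrightarrow> topological_group (G i) (T i)"
    and cech: "\<And>i. i \<in> I \<Longrightarrow> cech_complete TYPE('k) (T i)"
    and sub: "subgroup H (product_group I G)"
    and coset_or_action:
      "(\<exists>K. subgroup K (product_group I G) \<and> K \<subseteq> H \<and>
            closedin (subtopology (product_topology T I) H) K \<and>
            X homeomorphic_space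
              coset_space ((product_group I G)\<lparr>carrier := H\<rparr>)
                          (subtopology (product_topology T I) H) K)
       \<or> (\<exists>act. cont_trans_dopen_action ((product_group I G)\<lparr>carrier := H\<rparr>)
                   (subtopology (product_topology T I) H) X act)"
  shows "metrizable_space X"
proof -
  interpret product_subgroup I G T H
    by (rule product_subgroup.intro[OF factors sub])
  from coset_or_action show ?thesis
  proof (elim disjE exE conjE)
    fix K
    assume K: "subgroup K (product_group I G)" "K \<subseteq> H"
      and hom: "X homeomorphic_space coset_space HG HT K"
    \<comment> \<open>The hypotheses on \<open>X\<close> pass to the coset space along the
      homeomorphism, and metrizability passes back.\<close>
    have "metrizable_space (coset_space HG HT K)"
    proof (rule coset_space_metrizable[OF cech])
      show "subgroup K HG"
        by (rule group.subgroup_incl[OF group_P K(1) sub K(2)])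
      show "compact_space (coset_space HG HT K)"
        using homeomorphic_compact_space[OF hom] compact(1) by blast
      show "Hausdorff_space (coset_space HG HT K)"
        using homeomorphic_Hausdorff_space[OF hom] compact(2) by blast
      show "first_countable (coset_space HG HT K)"
        using homeomorphic_space_first_countability[OF hom] character by blast
    qed
    then show ?thesis
      using homeomorphic_metrizable_space[OF hom] by blast
  next
    fix act assume act: "cont_trans_dopen_action HG HT X act"
    have carr: "carrier HG = H"
      by simp
    have cont: "continuous_map (prod_topology HT X) X (\<lambda>(g, x). act g x)"
      using act unfolding cont_trans_dopen_action_def by blast
    show ?thesis
    proof (rule separately_continuous_action_metrizable[OF cech compact character, where act = act])
      fix g assume g: "g \<in> H"
      have "continuous_map X (prod_topology HT X) (\<lambda>x. (g, x))"
        using g topspace_HT by (intro continuous_map_pairedI) auto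
      from continuous_map_compose[OF this cont] show "continuous_map X X (act g)"
        by (simp add: o_def)
    next
      fix x assume x: "x \<in> topspace X"
      have "continuous_map HT (prod_topology HT X) (\<lambda>g. (g, x))"
        using x by (intro continuous_map_pairedI) auto
      from continuous_map_compose[OF this cont] show "continuous_map HT X (\<lambda>g. act g x)"
        by (simp add: o_def)
    qed (use act in \<open>unfold cont_trans_dopen_action_def carr, blast\<close>)+
  qed
qed

end
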